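(* Let $G$ be a finite $2$-group of nilpotency class $3$. If $\mathrm{d}(G)>4$, then $G$ has a non-inner automorphism of order $2$ that fixes every element of $\Phi(G)$.
   Context: $\mathrm{d}(G)$ is the minimum number of generators of $G$ and $\Phi(G)$ is its Frattini subgroup. A non-inner automorphism is one that is not conjugation by a group element. *)

theory Defs
  imports "HOL-Algebra.Algebra" "HOL-Algebra.Bij"
begin

text \<open>
  The lower central series, with the index shifted by one: \<open>lower_central G n\<close> is
  the term usually written \<open>\<gamma>\<^bsub>n+1\<^esub>(G)\<close>, so that \<open>lower_central G 0\<close> is \<open>G\<close> itself.
  Commutators are written as in \<^const>\<open>derived_set\<close>.
\<close>

primrec lower_central :: "('a, 'b) monoid_scheme \<Rightarrow> nat \<Rightarrow> 'a set" where
  "lower_central G 0 = carrier G"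
| "lower_central G (Suc n) =
     generate G {x \<otimes>\<^bsub>G\<^esub> y \<otimes>\<^bsub>G\<^esub> inv\<^bsub>G\<^esub> x \<otimes>\<^bsub>G\<^esub> inv\<^bsub>G\<^esub> y | x y.
                   x \<in> lower_central G n \<and> y \<in> carrier G}"

text \<open>The class is exactly \<open>c\<close>, not merely at most \<open>c\<close>.\<close>

definition nilpotent_of_class :: "('a, 'b) monoid_scheme \<Rightarrow> nat \<Rightarrow> bool" where
  "nilpotent_of_class G c \<longleftrightarrow>
     lower_central G c = {\<one>\<^bsub>G\<^esub>} \<and> (\<forall>m<c. lower_central G m \<noteq> {\<one>\<^bsub>G\<^esub>})"

definition maximal_subgroup :: "'a set \<Rightarrow> ('a, 'b) monoid_scheme \<Rightarrow> bool" where
  "maximal_subgroup M G \<longleftrightarrow>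
     subgroup M G \<and> M \<noteq> carrier G \<and>
     (\<forall>K. subgroup K G \<and> M \<subseteq> K \<longrightarrow> K = M \<or> K = carrier G)"

text \<open>Intersecting with the carrier gives \<open>G\<close> itself if there are no maximal subgroups.\<close>

definition frattini :: "('a, 'b) monoid_scheme \<Rightarrow> 'a set" where
  "frattini G = carrier G \<inter> \<Inter>{M. maximal_subgroup M G}"

text \<open>Meaningful only for finitely generated groups.\<close>

definition min_generators :: "('a, 'b) monoid_scheme \<Rightarrow> nat" where
  "min_generators G =
     (LEAST n. \<exists>S. S \<subseteq> carrier G \<and> finite S \<and> card S = n \<and> generate G S = carrier G)"

text \<open>
  Elements of \<^const>\<open>auto\<close> are extensional functions on the carrier,
  hence the restriction in the definition of inner automorphisms.
\<close>

definition inner_auto :: "('a, 'b) monoid_scheme \<Rightarrow> ('a \<Rightarrow> 'a) set" where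
  "inner_auto G =
     {(\<lambda>x\<in>carrier G. g \<otimes>\<^bsub>G\<^esub> x \<otimes>\<^bsub>G\<^esub> inv\<^bsub>G\<^esub> g) | g. g \<in> carrier G}"

end

theory Submission
  imports Defs
begin

text \<open>
  Suppose that every automorphism of order two that fixes \<open>\<Phi>(G)\<close> pointwise is inner. Write \<open>Z\<close> for the centre,
  \<open>R = \<Omega>\<^sub>1(Z)\<close>, \<open>d = d(G)\<close> and \<open>V = G/\<Phi>(G)\<close>, a vector space of dimension \<open>d\<close> over the field with two elements.

  Every homomorphism \<open>V \<rightarrow> R\<close> gives a central automorphism, so it has the form \<open>x \<mapsto> [b, x]\<close>. The elements \<open>b\<close>
  that occur lie in \<open>\<Phi>(G)\<close>: if one does not, then either the symmetry of \<open>[b, c]\<close> contradicts \<open>|R| > 2\<close>, or \<open>G\<close> has a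
  central factor generated modulo \<open>Z\<close> by \<open>u, v\<close> with \<open>u\<^sup>2 = v\<^sup>2\<close>, and swapping \<open>u\<close> and \<open>v\<close> is not inner. Hence these
  elements commute with each other.

  A quadratic map \<open>q : V \<rightarrow> R\<close> all of whose partial polar forms \<open>[w, -]\<close> can be realised with \<open>w\<^sup>2 = 1\<close> gives the
  derivation \<open>x \<mapsto> w(x) q(x)\<close> and thus an automorphism of order at most two. It is conjugation by some \<open>c\<close> with
  \<open>[[c, x], y]\<close> equal to the polar form, and \<open>c\<^sup>2 \<in> Z\<^sub>2(G)\<close>. As \<open>G\<close> has class three, \<open>G/Z\<^sub>2(G)\<close> is abelian with \<open>d\<close>
  generators, so there are at most \<open>2\<^sup>d\<close> such polar forms. There are \<open>|R|\<close> to the power \<open>d(d-1)/2\<close> alternating forms in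
  all, and since \<open>|Z/Z\<^sup>2| = |R|\<close> the condition \<open>w\<^sup>2 = 1\<close> loses a factor of at most \<open>|R|\<^sup>d\<close>. For \<open>d \<ge> 5\<close> this is too many
  unless \<open>|R| = 2\<close>; in that case a dual basis of \<open>V\<close> can be chosen in which at most one coordinate is not
  realised by an involution, and the forms in the other \<open>d - 1\<close> coordinates suffice.
\<close>

section \<open>Subgroups of index at most two\<close>

context group
begin

lemma inv_cancel_left [simp]:
  "\<lbrakk>x \<in> carrier G; y \<in> carrier G\<rbrakk> \<Longrightarrow> inv x \<otimes> (x \<otimes> y) = y"
  "\<lbrakk>x \<in> carrier G; y \<in> carrier G\<rbrakk> \<Longrightarrow> x \<otimes> (inv x \<otimes> y) = y"
  by (simp_all flip: m_assoc)

lemmas word_simps = m_assoc inv_mult_group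

section \<open>Commutator identities\<close>

definition commutator :: "'a \<Rightarrow> 'a \<Rightarrow> 'a" where
  "commutator x y = x \<otimes> y \<otimes> inv x \<otimes> inv y"

lemma commutator_closed [simp]:
  "\<lbrakk>x \<in> carrier G; y \<in> carrier G\<rbrakk> \<Longrightarrow> commutator x y \<in> carrier G"
  by (simp add: commutator_def)

lemma commutator_mult_left:
  "\<lbrakk>x \<in> carrier G; y \<in> carrier G; z \<in> carrier G\<rbrakk> \<Longrightarrow>
    commutator (x \<otimes> y) z = x \<otimes> commutator y z \<otimes> inv x \<otimes> commutator x z"
  by (simp add: commutator_def word_simps)

lemma commutator_mult_right:
  "\<lbrakk>x \<in> carrier G; y \<in> carrier G; z \<in> carrier G\<rbrakk> \<Longrightarrow>
    commutator x (y \<otimes> z) = commutator x y \<otimes> (y \<otimes> commutator x z \<otimes> inv y)"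
  by (simp add: commutator_def word_simps)

lemma inv_commutator:
  "\<lbrakk>x \<in> carrier G; y \<in> carrier G\<rbrakk> \<Longrightarrow> inv (commutator x y) = commutator y x"
  by (simp add: commutator_def word_simps)

lemma mult_eq_commutator:
  "\<lbrakk>x \<in> carrier G; y \<in> carrier G\<rbrakk> \<Longrightarrow> x \<otimes> y = commutator x y \<otimes> (y \<otimes> x)"
  by (simp add: commutator_def word_simps)

lemma commutator_eq_one_iff:
  "\<lbrakk>x \<in> carrier G; y \<in> carrier G\<rbrakk> \<Longrightarrow> commutator x y = \<one> \<longleftrightarrow> x \<otimes> y = y \<otimes> x"
  by (metis mult_eq_commutator r_cancel_one' m_closed commutator_closed l_one)

text \<open>These are the kernels of homomorphisms to the group of order two; for a finite 2-group
  they are the kernels of the linear forms on V, with \<open>carrier G\<close> for the zero form.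
  Expressing the homomorphism property as an equivalence of memberships reduces later proofs to case
  distinctions.\<close>

definition index_le_two :: "'a set \<Rightarrow> bool" where
  "index_le_two N \<longleftrightarrow> N \<subseteq> carrier G \<and>
     (\<forall>x\<in>carrier G. \<forall>y\<in>carrier G. x \<otimes> y \<in> N \<longleftrightarrow> (x \<in> N \<longleftrightarrow> y \<in> N))"

lemma index_le_two_mult:
  "\<lbrakk>index_le_two N; x \<in> carrier G; y \<in> carrier G\<rbrakk> \<Longrightarrow> x \<otimes> y \<in> N \<longleftrightarrow> (x \<in> N \<longleftrightarrow> y \<in> N)"
  by (auto simp: index_le_two_def)

lemma index_le_two_one: "index_le_two N \<Longrightarrow> \<one> \<in> N"
  using index_le_two_mult[of N \<one> \<one>] by simp

lemma index_le_two_inv: "\<lbrakk>index_le_two N; x \<in> carrier G\<rbrakk> \<Longrightarrow> inv x \<in> N \<longleftrightarrow> x \<in> N"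
  using index_le_two_mult[of N x "inv x"] index_le_two_one[of N] by simp

lemma index_le_two_subgroup:
  assumes "index_le_two N" shows "subgroup N G"
proof (rule subgroupI)
  show sub: "N \<subseteq> carrier G" using assms by (simp add: index_le_two_def)
  show "N \<noteq> {}" using index_le_two_one[OF assms] by blast
  show "inv a \<in> N" if "a \<in> N" for a using index_le_two_inv[OF assms] sub that by blast
  show "a \<otimes> b \<in> N" if "a \<in> N" "b \<in> N" for a b
    using index_le_two_mult[OF assms] sub that by blast
qed

section \<open>Subgroups containing all squares\<close>

definition square_subgroup :: "'a set \<Rightarrow> bool" where
  "square_subgroup H \<longleftrightarrow> subgroup H G \<and> (\<forall>x\<in>carrier G. x \<otimes> x \<in> H)"

text \<open>Closure under products and inverses also needs conjugation by \<open>inv y\<close>; it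
  follows from conjugation by \<open>y\<close> because \<open>y \<otimes> y\<close> lies in
  \<open>H\<close>.\<close>

lemma subgroup_union_coset:
  assumes H: "subgroup H G" and y: "y \<in> carrier G" and yy: "y \<otimes> y \<in> H"
    and conj: "\<And>h. h \<in> H \<Longrightarrow> y \<otimes> h \<otimes> inv y \<in> H"
  shows "subgroup (H \<union> (y <# H)) G"
proof -
  interpret H: subgroup H G by (rule H)
  note Hc = H.mem_carrier
  have conj': "inv y \<otimes> h \<otimes> y \<in> H" if h: "h \<in> H" for h
  proof -
    have "inv y \<otimes> h \<otimes> y = inv (y \<otimes> y) \<otimes> (y \<otimes> h \<otimes> inv y) \<otimes> (y \<otimes> y)"
      using h y by (simp add: word_simps Hc)
    then show ?thesis
      using conj[OF h] yy by simp
  qed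
  have mem: "x \<in> H \<union> (y <# H) \<longleftrightarrow> x \<in> H \<or> inv y \<otimes> x \<in> H" if "x \<in> carrier G" for x
  proof -
    have "x \<in> (y <# H) \<longleftrightarrow> inv y \<otimes> x \<in> H"
    proof
      assume "inv y \<otimes> x \<in> H"
      then have "y \<otimes> (inv y \<otimes> x) \<in> y <# H" unfolding l_coset_def by blast
      then show "x \<in> y <# H" using that y by simp
    qed (use that y Hc in \<open>auto simp: l_coset_def\<close>)
    then show ?thesis by simp
  qed
  show ?thesis
  proof (rule subgroupI)
    show "H \<union> (y <# H) \<subseteq> carrier G"
      using H.subset y by (auto simp: l_coset_def)
    show "H \<union> (y <# H) \<noteq> {}" using H.one_closed by blast
  next
    fix a assume "a \<in> H \<union> (y <# H)"
    then consider "a \<in> H" | h where "a = y \<otimes> h" "h \<in> H" by (auto simp: l_coset_def)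
    then show "inv a \<in> H \<union> (y <# H)"
    proof cases
      case 2
      have "inv y \<otimes> inv a = inv (y \<otimes> y) \<otimes> (y \<otimes> inv h \<otimes> inv y)"
        using 2 y by (simp add: word_simps Hc)
      also have "\<dots> \<in> H" using conj[of "inv h"] 2 yy by simp
      finally show ?thesis using mem 2 y Hc by simp
    qed simp
  next
    fix a b assume "a \<in> H \<union> (y <# H)" "b \<in> H \<union> (y <# H)"
    then consider "a \<in> H" "b \<in> H" | h where "a = y \<otimes> h" "h \<in> H" "b \<in> H"
      | h where "b = y \<otimes> h" "h \<in> H" "a \<in> H" | h k where "a = y \<otimes> h" "b = y \<otimes> k" "h \<in> H" "k \<in> H"
      by (auto simp: l_coset_def)
    then show "a \<otimes> b \<in> H \<union> (y <# H)"
    proof cases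
      case 1 then show ?thesis by simp
    next
      case 2
      then have "inv y \<otimes> (a \<otimes> b) = h \<otimes> b" using y by (simp add: word_simps Hc)
      then show ?thesis using mem 2 y Hc by simp
    next
      case 3
      then have "inv y \<otimes> (a \<otimes> b) = (inv y \<otimes> a \<otimes> y) \<otimes> h" using y by (simp add: word_simps Hc)
      then show ?thesis using mem 3 y Hc conj' by simp
    next
      case 4
      then have "a \<otimes> b = (y \<otimes> h \<otimes> inv y) \<otimes> (y \<otimes> y) \<otimes> k" using y by (simp add: word_simps Hc)
      then show ?thesis using 4 yy conj by simp
    qed
  qed
qed

text \<open>The identity y h y^-1 = (y h)^2 h^-1 y^-2 writes the conjugate as a product of elements
  of \<open>H\<close>.\<close>

lemma square_subgroup_conj:
  assumes "square_subgroup H" "y \<in> carrier G" "h \<in> H"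
  shows "y \<otimes> h \<otimes> inv y \<in> H"
proof -
  interpret H: subgroup H G using assms by (simp add: square_subgroup_def)
  have h: "h \<in> carrier G" using assms H.mem_carrier by blast
  have "y \<otimes> h \<otimes> inv y = ((y \<otimes> h) \<otimes> (y \<otimes> h)) \<otimes> inv h \<otimes> inv (y \<otimes> y)"
    using assms h by (simp add: word_simps)
  then show ?thesis
    using assms h by (simp add: square_subgroup_def)
qed

lemma square_subgroup_union:
  assumes "square_subgroup H" "y \<in> carrier G"
  shows "square_subgroup (H \<union> (y <# H))"
  using subgroup_union_coset[of H y] square_subgroup_conj[OF assms] assms
  by (auto simp: square_subgroup_def)

text \<open>Two elements a = y h and b = y k outside \<open>H\<close> have product a^2 h^-1 k, which
  lies in \<open>H\<close> because the square does.\<close>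

lemma index_le_two_if_cover:
  assumes H: "square_subgroup H" and cov: "carrier G \<subseteq> H \<union> (y <# H)" and y: "y \<in> carrier G"
  shows "index_le_two H"
proof -
  interpret H: subgroup H G using H by (simp add: square_subgroup_def)
  note Hc = H.mem_carrier
  have 1: "a \<otimes> b \<in> H \<longleftrightarrow> b \<in> H" if "a \<in> H" "b \<in> carrier G" for a b
    using that Hc by (metis H.m_closed H.m_inv_closed inv_cancel_left(1))
  have 2: "a \<otimes> b \<in> H \<longleftrightarrow> a \<in> H" if "b \<in> H" "a \<in> carrier G" for a b
    using that Hc by (metis H.m_closed H.m_inv_closed inv_closed m_assoc r_inv r_one)
  have 3: "a \<otimes> b \<in> H" if "a \<notin> H" "b \<notin> H" "a \<in> carrier G" "b \<in> carrier G" for a b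
  proof -
    have "a \<in> y <# H" "b \<in> y <# H" using that cov by auto
    then obtain h k where hk: "a = y \<otimes> h" "b = y \<otimes> k" "h \<in> H" "k \<in> H"
      by (auto simp: l_coset_def)
    then have "a \<otimes> b = (a \<otimes> a) \<otimes> inv h \<otimes> k"
      using y by (simp add: word_simps Hc)
    then show ?thesis using that H hk by (simp add: square_subgroup_def)
  qed
  show ?thesis
    unfolding index_le_two_def
  proof (intro conjI ballI H.subset)
    fix a b assume "a \<in> carrier G" "b \<in> carrier G"
    then show "a \<otimes> b \<in> H \<longleftrightarrow> (a \<in> H \<longleftrightarrow> b \<in> H)"
      using 1[of a b] 2[of b a] 3[of a b] by (cases "a \<in> H"; cases "b \<in> H") simp_all
  qed
qed

text \<open>Linear forms separate points from subspaces. Take \<open>K\<close> maximal among the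
  square subgroups that contain \<open>H\<close> and miss \<open>x\<close>: adjoining the coset of
  any \<open>y\<close> outside \<open>K\<close> brings in \<open>x\<close>, so \<open>K\<close> and
  its coset by \<open>x\<close> cover the group.\<close>

lemma index_le_two_separation:
  assumes fin: "finite (carrier G)" and H: "square_subgroup H" and x: "x \<in> carrier G" "x \<notin> H"
  obtains N where "index_le_two N" "H \<subseteq> N" "x \<notin> N"
proof -
  let ?K = "{K. square_subgroup K \<and> H \<subseteq> K \<and> x \<notin> K}"
  have "?K \<subseteq> Pow (carrier G)" using subgroup.subset by (auto simp: square_subgroup_def)
  then have "finite ?K" using fin finite_subset by blast
  moreover have "H \<in> ?K" using H x by simp
  ultimately obtain K where K: "K \<in> ?K" and max: "\<And>L. L \<in> ?K \<Longrightarrow> K \<subseteq> L \<Longrightarrow> L = K"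
    using finite_has_maximal2[of ?K H] by (metis (no_types, lifting))
  interpret K: subgroup K G using K by (simp add: square_subgroup_def)
  have "y \<in> K \<union> (x <# K)" if y: "y \<in> carrier G" for y
  proof (rule ccontr)
    assume n: "y \<notin> K \<union> (x <# K)"
    have "y \<in> (y <# K)" using y K.one_closed by (force simp: l_coset_def)
    then have "K \<union> (y <# K) \<noteq> K" using n by blast
    then have "K \<union> (y <# K) \<notin> ?K" using max by blast
    then have "x \<in> K \<union> (y <# K)" using K square_subgroup_union y by blast
    then obtain k where k: "x = y \<otimes> k" "k \<in> K" using K by (auto simp: l_coset_def)
    then have "y = x \<otimes> inv k" using y K.mem_carrier by (simp add: word_simps)
    then show False using n k by (auto simp: l_coset_def)
  qed
  then have "index_le_two K" using index_le_two_if_cover K x by blast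
  then show thesis using that K by blast
qed

text \<open>A proper \<open>N\<close> is maximal: if \<open>k\<close> in \<open>K\<close> lies
  outside \<open>N\<close> and \<open>g\<close> lies outside \<open>K\<close>, then
  \<open>g \<otimes> inv k\<close> lies in \<open>N\<close>, which forces \<open>g\<close> into
  \<open>K\<close>.\<close>

lemma frattini_subset_index_le_two:
  assumes N: "index_le_two N" shows "frattini G \<subseteq> N"
proof (cases "N = carrier G")
  case False
  have "K = N \<or> K = carrier G" if K: "subgroup K G" "N \<subseteq> K" for K
  proof (rule disjCI)
    assume "K \<noteq> carrier G"
    then obtain g where g: "g \<in> carrier G" "g \<notin> K" using subgroup.subset[OF K(1)] by blast
    have "k \<in> N" if k: "k \<in> K" for k
    proof (rule ccontr)
      assume "k \<notin> N"
      have kc: "k \<in> carrier G" by (rule subgroup.mem_carrier[OF K(1) k])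
      have "g \<otimes> inv k \<in> K"
        using index_le_two_mult[OF N, of g "inv k"] index_le_two_inv[OF N kc] \<open>k \<notin> N\<close> g kc K(2)
        by auto
      then have "g \<otimes> inv k \<otimes> k \<in> K" by (rule subgroup.m_closed[OF K(1) _ k])
      then show False using g kc by (simp add: word_simps)
    qed
    then show "K = N" using K by blast
  qed
  then have "maximal_subgroup N G"
    using False index_le_two_subgroup[OF N] by (auto simp: maximal_subgroup_def)
  then show ?thesis by (auto simp: frattini_def)
qed (auto simp: frattini_def)

end

section \<open>Involutory automorphisms and generating sets of 2-groups\<close>

context group
begin

text \<open>Automorphisms are built below as plain functions; this turns them into elements of
  \<open>auto G\<close>. The order is exactly two because the identity is inner.\<close>

lemma involution_auto:
  assumes closed: "\<And>x. x \<in> carrier G \<Longrightarrow> f x \<in> carrier G"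
    and mult: "\<And>x y. \<lbrakk>x \<in> carrier G; y \<in> carrier G\<rbrakk> \<Longrightarrow> f (x \<otimes> y) = f x \<otimes> f y"
    and invol: "\<And>x. x \<in> carrier G \<Longrightarrow> f (f x) = x"
    and outer: "\<not> (\<exists>c\<in>carrier G. \<forall>x\<in>carrier G. f x = c \<otimes> x \<otimes> inv c)"
  defines "F \<equiv> restrict f (carrier G)"
  shows "F \<in> auto G" "F \<notin> inner_auto G" "group.ord (AutoGroup G) F = 2"
proof -
  interpret A: group "AutoGroup G" by (rule AutoGroup)
  have "bij_betw f (carrier G) (carrier G)"
    by (rule bij_betw_byWitness[where f' = f]) (use closed invol in auto)
  then have "F \<in> Bij (carrier G)"
    by (simp add: F_def Bij_def cong: bij_betw_cong)
  moreover have "F \<in> hom G G" using closed mult by (simp add: F_def hom_def)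
  ultimately show F: "F \<in> auto G" by (simp add: auto_def)
  show inner: "F \<notin> inner_auto G"
  proof
    assume "F \<in> inner_auto G"
    then obtain c where c: "c \<in> carrier G" "F = (\<lambda>x\<in>carrier G. c \<otimes> x \<otimes> inv c)"
      by (auto simp: inner_auto_def)
    then have "f x = c \<otimes> x \<otimes> inv c" if "x \<in> carrier G" for x
      using that by (simp add: F_def) (metis restrict_apply')
    with outer c show False by blast
  qed
  have Fc: "F \<in> carrier (AutoGroup G)" using F by (simp add: AutoGroup_def)
  have one: "\<one>\<^bsub>AutoGroup G\<^esub> = (\<lambda>x\<in>carrier G. x)"
    by (simp add: AutoGroup_def BijGroup_def)
  have "F \<otimes>\<^bsub>AutoGroup G\<^esub> F = \<one>\<^bsub>AutoGroup G\<^esub>"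
    using \<open>F \<in> Bij (carrier G)\<close> closed invol
    by (auto simp: one AutoGroup_def BijGroup_def compose_def F_def intro!: restrict_ext)
  then have "F [^]\<^bsub>AutoGroup G\<^esub> (2::nat) = \<one>\<^bsub>AutoGroup G\<^esub>"
    using Fc by (simp add: numeral_2_eq_2)
  then have "A.ord F dvd 2" using Fc A.pow_eq_id by blast
  moreover have "F \<noteq> \<one>\<^bsub>AutoGroup G\<^esub>"
  proof
    assume "F = \<one>\<^bsub>AutoGroup G\<^esub>"
    moreover have "\<one>\<^bsub>AutoGroup G\<^esub> = (\<lambda>x\<in>carrier G. \<one> \<otimes> x \<otimes> inv \<one>)"
      unfolding one by (rule restrict_ext) simp
    ultimately have "F = (\<lambda>x\<in>carrier G. \<one> \<otimes> x \<otimes> inv \<one>)" by (rule trans)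
    then have "F \<in> inner_auto G" unfolding inner_auto_def by blast
    with inner show False by contradiction
  qed
  ultimately show "A.ord F = 2"
    using Fc A.ord_eq_1 by (metis prime_nat_iff two_is_prime_nat)
qed

section \<open>The lower central series and maximal subgroups\<close>

lemma lower_central_subgroup: "subgroup (lower_central G n) G"
proof (induction n)
  case (Suc n)
  then have "{x \<otimes> y \<otimes> inv x \<otimes> inv y |x y. x \<in> lower_central G n \<and> y \<in> carrier G} \<subseteq> carrier G"
    using subgroup.mem_carrier[OF Suc] by auto
  then show ?case by (simp add: generate_is_subgroup)
qed (simp add: subgroup_self)

lemma commutator_lower_central:
  "\<lbrakk>x \<in> lower_central G n; y \<in> carrier G\<rbrakk> \<Longrightarrow> commutator x y \<in> lower_central G (Suc n)"
  by (auto simp: commutator_def intro!: generate.incl)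

text \<open>Normalisers grow. The term of the lower central series just before the first one inside
  \<open>M\<close> has all its commutators in \<open>M\<close>, so it normalises \<open>M\<close>.
  The normaliser is thus larger than \<open>M\<close>, hence everything.\<close>

lemma maximal_subgroup_normal:
  assumes lc: "lower_central G c = {\<one>}" and M: "maximal_subgroup M G"
    and g: "g \<in> carrier G" and m: "m \<in> M"
  shows "g \<otimes> m \<otimes> inv g \<in> M"
proof -
  interpret M: subgroup M G using M by (simp add: maximal_subgroup_def)
  note Mc = M.mem_carrier
  define i where "i = (LEAST i. lower_central G i \<subseteq> M)"
  have i: "lower_central G i \<subseteq> M"
    unfolding i_def by (rule LeastI[of _ c]) (simp add: lc)
  have "i \<noteq> 0" using i M M.subset by (auto simp: maximal_subgroup_def)
  then obtain j where j: "i = Suc j" by (cases i) auto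
  then have "\<not> lower_central G j \<subseteq> M"
    using not_less_Least[of j "\<lambda>i. lower_central G i \<subseteq> M"] by (simp add: i_def)
  then obtain a where a: "a \<in> lower_central G j" "a \<notin> M" by blast
  interpret L: subgroup "lower_central G j" G by (rule lower_central_subgroup)
  have conj: "b \<otimes> k \<otimes> inv b \<in> M" if "b \<in> lower_central G j" "k \<in> M" for b k
  proof -
    have "b \<otimes> k \<otimes> inv b = commutator b k \<otimes> k"
      using that L.mem_carrier Mc by (simp add: commutator_def word_simps)
    then show ?thesis
      using commutator_lower_central[of b j k] i j that Mc by auto
  qed
  \<comment> \<open>The normaliser of \<open>M\<close>; asking for conjugation by
    \<open>inv g\<close> as well makes closure under inverses immediate.\<close>
  define K where "K = {g \<in> carrier G. \<forall>k\<in>M. g \<otimes> k \<otimes> inv g \<in> M \<and> inv g \<otimes> k \<otimes> g \<in> M}"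
  have "subgroup K G"
  proof (rule subgroupI)
    have "\<one> \<in> K" by (simp add: K_def Mc)
    then show "K \<noteq> {}" by blast
    show "inv x \<in> K" if "x \<in> K" for x using that by (auto simp: K_def)
    fix x y assume xy: "x \<in> K" "y \<in> K"
    have "x \<otimes> y \<otimes> k \<otimes> inv (x \<otimes> y) = x \<otimes> (y \<otimes> k \<otimes> inv y) \<otimes> inv x"
      "inv (x \<otimes> y) \<otimes> k \<otimes> (x \<otimes> y) = inv y \<otimes> (inv x \<otimes> k \<otimes> x) \<otimes> y" if "k \<in> M" for k
      using xy that by (simp_all add: K_def word_simps Mc)
    then show "x \<otimes> y \<in> K" using xy by (simp add: K_def)
  qed (auto simp: K_def)
  moreover have "M \<subseteq> K" by (auto simp: K_def Mc)
  moreover have "a \<in> K"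
    using a conj[of a] conj[of "inv a"] L.mem_carrier by (auto simp: K_def)
  ultimately have "K = carrier G" using M a by (auto simp: maximal_subgroup_def)
  then show ?thesis using g m by (auto simp: K_def)
qed

text \<open>In the chain of repeated squares of \<open>x\<close>, let \<open>y\<close> be the last
  element before the chain enters \<open>M\<close>. Then y^2 is in \<open>M\<close>, so
  \<open>M\<close> and y M cover the group, and x = y m has its square in \<open>M\<close> by
  normality.\<close>

lemma maximal_subgroup_square_subgroup:
  assumes "order G = 2 ^ n" and lc: "lower_central G c = {\<one>}" and M: "maximal_subgroup M G"
  shows "square_subgroup M"
proof -
  interpret M: subgroup M G using M by (simp add: maximal_subgroup_def)
  note Mc = M.mem_carrier
  have "x \<otimes> x \<in> M" if x: "x \<in> carrier G" for x
  proof (cases "x \<in> M")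
    case False
    define k where "k = (LEAST k. x [^] ((2::nat) ^ k) \<in> M)"
    have k: "x [^] ((2::nat) ^ k) \<in> M"
      unfolding k_def by (rule LeastI[of _ n]) (use x pow_order_eq_1 assms in \<open>metis M.one_closed\<close>)
    have "k \<noteq> 0" using k False x by (auto intro: gr0I)
    then obtain j where j: "k = Suc j" by (cases k) auto
    define y where "y = x [^] ((2::nat) ^ j)"
    have yM: "y \<notin> M"
      using not_less_Least[of j "\<lambda>k. x [^] ((2::nat) ^ k) \<in> M"] j by (simp add: k_def y_def)
    have yc: "y \<in> carrier G" using x by (simp add: y_def)
    have yy: "y \<otimes> y \<in> M"
      using k x by (simp add: j y_def nat_pow_mult mult_2)
    have conj: "\<And>h. h \<in> M \<Longrightarrow> y \<otimes> h \<otimes> inv y \<in> M"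
      using maximal_subgroup_normal[OF lc M yc] .
    have "subgroup (M \<union> (y <# M)) G" by (rule subgroup_union_coset) (use yc yy conj M.subgroup_axioms in auto)
    moreover have "y \<in> y <# M" using yc M.one_closed by (force simp: l_coset_def)
    ultimately have "M \<union> (y <# M) = carrier G" using M yM by (auto simp: maximal_subgroup_def)
    then have "x \<in> y <# M" using False x by blast
    then obtain m where m: "m \<in> M" "x = y \<otimes> m" by (auto simp: l_coset_def)
    then have "x \<otimes> x = (y \<otimes> m \<otimes> inv y) \<otimes> (y \<otimes> y) \<otimes> m" using yc Mc by (simp add: word_simps)
    then show ?thesis using conj yy m by simp
  qed simp
  then show ?thesis by (simp add: square_subgroup_def M.subgroup_axioms)
qed

section \<open>Minimal generating sets and dual coordinates\<close>

lemma exists_maximal_subgroup: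
  assumes fin: "finite (carrier G)" and K: "subgroup K G" "K \<noteq> carrier G"
  obtains M where "maximal_subgroup M G" "K \<subseteq> M"
proof -
  let ?L = "{L. subgroup L G \<and> L \<noteq> carrier G}"
  have "?L \<subseteq> Pow (carrier G)" using subgroup.subset by auto
  then have "finite ?L" using fin finite_subset by blast
  moreover have "K \<in> ?L" using K by simp
  ultimately obtain M where "M \<in> ?L" "K \<subseteq> M" "\<And>L. L \<in> ?L \<Longrightarrow> M \<subseteq> L \<Longrightarrow> L = M"
    using finite_has_maximal2[of ?L K] by (metis (no_types, lifting))
  then show thesis using that[of M] by (auto simp: maximal_subgroup_def)
qed

lemma generate_square_subgroup:
  assumes "A \<subseteq> carrier G"
  shows "square_subgroup (generate G (A \<union> {x \<otimes> x |x. x \<in> carrier G}))"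
proof -
  have "A \<union> {x \<otimes> x |x. x \<in> carrier G} \<subseteq> carrier G" using assms by auto
  then show ?thesis
    unfolding square_subgroup_def by (auto intro!: generate_is_subgroup generate.incl)
qed

text \<open>The argument of the Burnside basis theorem. If the subgroup \<open>H\<close> generated
  by \<open>S - {s}\<close> and all squares contained \<open>s\<close>, it would be the whole group.
  But by minimality \<open>S - {s}\<close> lies in a maximal subgroup, which contains all squares
  and hence \<open>H\<close>. So \<open>s\<close> can be separated from \<open>H\<close>, and
  \<open>N s\<close> is the kernel of the coordinate at \<open>s\<close>.\<close>

lemma min_generators_dual:
  assumes fin: "finite (carrier G)" and ord: "order G = 2 ^ n" and lc: "lower_central G c = {\<one>}"
  obtains S N where "finite S" "S \<subseteq> carrier G" "card S = min_generators G" "generate G S = carrier G"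
    "\<And>s. s \<in> S \<Longrightarrow> index_le_two (N s)"
    "\<And>s t. \<lbrakk>s \<in> S; t \<in> S\<rbrakk> \<Longrightarrow> t \<in> N s \<longleftrightarrow> t \<noteq> s"
proof -
  let ?P = "\<lambda>n. \<exists>S. S \<subseteq> carrier G \<and> finite S \<and> card S = n \<and> generate G S = carrier G"
  have gen: "generate G (carrier G) = carrier G"
    using generate_incl[of "carrier G"] generate.incl[of _ "carrier G" G] by blast
  have "?P (min_generators G)"
    unfolding min_generators_def by (rule LeastI[of ?P "card (carrier G)"]) (use fin gen in auto)
  then obtain S where S: "S \<subseteq> carrier G" "finite S" "card S = min_generators G" "generate G S = carrier G"
    by blast
  have "\<exists>N. index_le_two N \<and> s \<notin> N \<and> S - {s} \<subseteq> N" if s: "s \<in> S" for s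
  proof -
    define H where "H = generate G ((S - {s}) \<union> {x \<otimes> x |x. x \<in> carrier G})"
    have H: "square_subgroup H" unfolding H_def using generate_square_subgroup S by blast
    have sub: "S - {s} \<subseteq> H" unfolding H_def by (auto intro: generate.incl)
    have "s \<notin> H"
    proof
      assume "s \<in> H"
      then have "S \<subseteq> H" using sub by blast
      then have "carrier G \<subseteq> H"
        using generate_subgroup_incl[of S H] H S by (simp add: square_subgroup_def)
      have "card (S - {s}) < min_generators G"
        using S s by (metis card_Diff1_less)
      then have "\<not> ?P (card (S - {s}))"
        unfolding min_generators_def by (rule not_less_Least)
      then have "generate G (S - {s}) \<noteq> carrier G" using S by blast
      moreover have "subgroup (generate G (S - {s})) G" using S by (auto intro: generate_is_subgroup)
      ultimately obtain M where M: "maximal_subgroup M G" "generate G (S - {s}) \<subseteq> M"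
        using exists_maximal_subgroup fin by blast
      have sq: "square_subgroup M" by (rule maximal_subgroup_square_subgroup[OF ord lc M(1)])
      have "(S - {s}) \<union> {x \<otimes> x |x. x \<in> carrier G} \<subseteq> M"
        using sq M(2) by (auto simp: square_subgroup_def intro: generate.incl)
      then have "H \<subseteq> M"
        unfolding H_def using sq by (intro generate_subgroup_incl) (auto simp: square_subgroup_def)
      then show False
        using \<open>carrier G \<subseteq> H\<close> M(1) subgroup.subset[of M G] by (auto simp: maximal_subgroup_def)
    qed
    moreover have "s \<in> carrier G" using s S by blast
    ultimately obtain N where "index_le_two N" "H \<subseteq> N" "s \<notin> N"
      using index_le_two_separation[OF fin H] by metis
    then show ?thesis using sub by blast
  qed
  then obtain N where "\<And>s. s \<in> S \<Longrightarrow> index_le_two (N s) \<and> s \<notin> N s \<and> S - {s} \<subseteq> N s"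
    by metis
  then show thesis using that[of S N] S by blast
qed

text \<open>Adjoining one element of \<open>S\<close> adds at most one coset, so the size at most
  doubles.\<close>

lemma card_le_two_power_square_subgroup:
  assumes fin: "finite (carrier G)" and "finite S" "S \<subseteq> carrier G" and H: "square_subgroup H"
  shows "\<exists>L. square_subgroup L \<and> H \<subseteq> L \<and> S \<subseteq> L \<and> card L \<le> 2 ^ card S * card H"
  using assms(2,3)
proof (induction S)
  case empty
  then show ?case using H by auto
next
  case (insert s S)
  then obtain L where L: "square_subgroup L" "H \<subseteq> L" "S \<subseteq> L" "card L \<le> 2 ^ card S * card H"
    by auto
  then interpret L: subgroup L G by (simp add: square_subgroup_def)
  have s: "s \<in> carrier G" using insert by simp
  have "card (s <# L) = card L"
  proof -
    have "s <# L = (\<lambda>x. s \<otimes> x) ` L" by (auto simp: l_coset_def)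
    then show ?thesis using s L.subset by (simp add: card_image inj_on_def subset_iff)
  qed
  then have "card (L \<union> (s <# L)) \<le> 2 * card L"
    by (metis card_Un_le mult_2)
  also have "\<dots> \<le> 2 ^ card (insert s S) * card H" using L insert by simp
  finally have "card (L \<union> (s <# L)) \<le> 2 ^ card (insert s S) * card H" .
  moreover have "s \<in> s <# L" using s L.one_closed by (force simp: l_coset_def)
  ultimately show ?case
    using square_subgroup_union[OF L(1) s] L by blast
qed

end

section \<open>Involutions in finite abelian groups\<close>

lemma (in comm_group) card_square_fibres:
  assumes fin: "finite (carrier G)"
  shows "card {x \<in> carrier G. x \<otimes> x = \<one>} * card ((\<lambda>x. x \<otimes> x) ` carrier G) = card (carrier G)"
proof -
  let ?T = "{x \<in> carrier G. x \<otimes> x = \<one>}"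
  \<comment> \<open>A nonempty fibre of the squaring map is a translate of its kernel.\<close>
  have fibre: "card {x \<in> carrier G. x \<otimes> x = y} = card ?T" if y: "y \<in> (\<lambda>x. x \<otimes> x) ` carrier G" for y
  proof -
    from y obtain a where a: "a \<in> carrier G" "y = a \<otimes> a" by blast
    have "bij_betw (\<lambda>x. a \<otimes> x) ?T {x \<in> carrier G. x \<otimes> x = y}"
    proof (rule bij_betw_byWitness[where f' = "\<lambda>x. inv a \<otimes> x"])
      show "(\<lambda>x. a \<otimes> x) ` ?T \<subseteq> {x \<in> carrier G. x \<otimes> x = y}"
      proof safe
        fix x assume x: "x \<in> carrier G" "x \<otimes> x = \<one>"
        have "a \<otimes> x \<otimes> (a \<otimes> x) = (a \<otimes> a) \<otimes> (x \<otimes> x)"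
          using a x(1) by (simp add: m_ac)
        then show "a \<otimes> x \<otimes> (a \<otimes> x) = y" using a x by simp
      qed (use a in auto)
      show "(\<lambda>x. inv a \<otimes> x) ` {x \<in> carrier G. x \<otimes> x = y} \<subseteq> ?T"
      proof safe
        fix x assume x: "x \<in> carrier G" "y = x \<otimes> x"
        have "inv a \<otimes> x \<otimes> (inv a \<otimes> x) = inv (a \<otimes> a) \<otimes> (x \<otimes> x)"
          using a(1) x(1) by (simp add: m_ac inv_mult)
        also have "\<dots> = inv y \<otimes> y" using a(2) x(2) by simp
        also have "\<dots> = \<one>" using a by simp
        finally show "inv a \<otimes> x \<otimes> (inv a \<otimes> x) = \<one>" .
      qed (use a in auto)
    qed (use a in auto)
    then show ?thesis by (simp add: bij_betw_same_card)
  qed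
  have "card (carrier G) = (\<Sum>x\<in>carrier G. 1)" by simp
  also have "\<dots> = (\<Sum>y\<in>(\<lambda>x. x \<otimes> x) ` carrier G. \<Sum>x | x \<in> carrier G \<and> x \<otimes> x = y. 1)"
    by (rule sum.image_gen[OF fin])
  also have "\<dots> = (\<Sum>y\<in>(\<lambda>x. x \<otimes> x) ` carrier G. card ?T)"
    by (rule sum.cong) (auto simp: fibre[symmetric])
  finally show ?thesis by (simp add: mult.commute)
qed

text \<open>By \<open>card_square_fibres\<close> the left-hand side is the index of the subgroup of
  squares, and modulo squares the group is spanned by \<open>S\<close>.\<close>

lemma (in comm_group) card_involutions_le:
  assumes fin: "finite (carrier G)" and S: "finite S" "S \<subseteq> carrier G" "generate G S = carrier G"
  shows "card {x \<in> carrier G. x \<otimes> x = \<one>} \<le> 2 ^ card S"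
proof -
  let ?H = "(\<lambda>x. x \<otimes> x) ` carrier G"
  have "subgroup ?H G"
  proof (rule subgroupI)
    fix a b assume "a \<in> ?H" "b \<in> ?H"
    then obtain x y where "x \<in> carrier G" "y \<in> carrier G" "a = x \<otimes> x" "b = y \<otimes> y" by blast
    then show "a \<otimes> b \<in> ?H" by (intro image_eqI[of _ _ "x \<otimes> y"]) (auto simp: m_ac)
  next
    fix a assume "a \<in> ?H"
    then obtain x where "x \<in> carrier G" "a = x \<otimes> x" by blast
    then show "inv a \<in> ?H" by (intro image_eqI[of _ _ "inv x"]) (auto simp: inv_mult)
  qed auto
  then have "square_subgroup ?H" by (auto simp: square_subgroup_def)
  then obtain L where L: "square_subgroup L" "S \<subseteq> L" "card L \<le> 2 ^ card S * card ?H"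
    using card_le_two_power_square_subgroup[OF fin S(1,2), of ?H] by blast
  then have "carrier G \<subseteq> L"
    using generate_subgroup_incl[of S L] S by (simp add: square_subgroup_def)
  then have "L = carrier G"
    using L(1) subgroup.subset[of L G] by (auto simp: square_subgroup_def)
  then have "card {x \<in> carrier G. x \<otimes> x = \<one>} * card ?H \<le> 2 ^ card S * card ?H"
    using L(3) card_square_fibres[OF fin] by simp
  moreover have "card ?H > 0" using fin by (auto simp: card_gt_0_iff)
  ultimately show ?thesis by simp
qed

section \<open>Groups in which every involution fixing the Frattini subgroup is inner\<close>

context group
begin

section \<open>The centre, its involutions and homomorphisms into them\<close>

definition centre :: "'a set" where
  "centre = {z \<in> carrier G. \<forall>x\<in>carrier G. z \<otimes> x = x \<otimes> z}"

text \<open>The group R; in a finite 2-group it is generated by the minimal normal subgroups, hence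
  the name.\<close>

definition socle :: "'a set" where
  "socle = {z \<in> centre. z \<otimes> z = \<one>}"

text \<open>Equivalently, the preimage of the elements of order at most two in the centre of
  G/Z.\<close>

definition socle_lift :: "'a set" where
  "socle_lift = {b \<in> carrier G. \<forall>x\<in>carrier G. commutator b x \<in> socle}"

text \<open>For a finite 2-group this is \<Phi>(G), described by linear conditions. The link to
  \<open>frattini\<close> is \<open>frattini_index_two_core\<close>.\<close>

definition index_two_core :: "'a set" where
  "index_two_core = {x \<in> carrier G. \<forall>N. index_le_two N \<longrightarrow> x \<in> N}"

definition socle_hom :: "('a \<Rightarrow> 'a) \<Rightarrow> bool" where
  "socle_hom h \<longleftrightarrow> (\<forall>x\<in>carrier G. h x \<in> socle) \<and>
     (\<forall>x\<in>carrier G. \<forall>y\<in>carrier G. h (x \<otimes> y) = h x \<otimes> h y)"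

lemma centre_closed: "z \<in> centre \<Longrightarrow> z \<in> carrier G"
  by (simp add: centre_def)

lemma centre_comm: "\<lbrakk>z \<in> centre; x \<in> carrier G\<rbrakk> \<Longrightarrow> z \<otimes> x = x \<otimes> z"
  by (simp add: centre_def)

lemma centre_left_comm:
  "\<lbrakk>z \<in> centre; x \<in> carrier G; y \<in> carrier G\<rbrakk> \<Longrightarrow> x \<otimes> (z \<otimes> y) = z \<otimes> (x \<otimes> y)"
  by (metis centre_closed centre_comm m_assoc)

lemma centre_subgroup: "subgroup centre G"
proof (rule subgroupI)
  have "\<one> \<in> centre" by (simp add: centre_def)
  then show "centre \<noteq> {}" by blast
  fix a assume a: "a \<in> centre"
  have "inv a \<otimes> x = x \<otimes> inv a" if "x \<in> carrier G" for x
  proof -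
    have "inv a \<otimes> x = inv a \<otimes> (x \<otimes> a) \<otimes> inv a" using that centre_closed[OF a] by (simp add: m_assoc)
    also have "x \<otimes> a = a \<otimes> x" using centre_comm[OF a that] by simp
    finally show ?thesis using that centre_closed[OF a] by (simp add: m_assoc)
  qed
  then show "inv a \<in> centre" using centre_closed[OF a] by (simp add: centre_def)
  fix b assume b: "b \<in> centre"
  have "a \<otimes> b \<otimes> x = x \<otimes> (a \<otimes> b)" if "x \<in> carrier G" for x
    using that centre_comm[OF b that] centre_left_comm[OF a that centre_closed[OF b]]
      centre_closed[OF a] centre_closed[OF b] by (simp add: m_assoc)
  then show "a \<otimes> b \<in> centre" using centre_closed[OF a] centre_closed[OF b] by (simp add: centre_def)
qed (auto simp: centre_def)

lemma centre_mult: "\<lbrakk>a \<in> centre; b \<in> centre\<rbrakk> \<Longrightarrow> a \<otimes> b \<in> centre"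
  using subgroup.m_closed[OF centre_subgroup] .

lemma centre_inv: "a \<in> centre \<Longrightarrow> inv a \<in> centre"
  using subgroup.m_inv_closed[OF centre_subgroup] .

lemma centre_comm_group: "comm_group (G\<lparr>carrier := centre\<rparr>)"
  using subgroup.subgroup_is_group[OF centre_subgroup is_group] centre_comm centre_closed
  by (intro group.group_comm_groupI) auto

lemma socle_centre: "z \<in> socle \<Longrightarrow> z \<in> centre"
  and socle_square: "z \<in> socle \<Longrightarrow> z \<otimes> z = \<one>"
  by (simp_all add: socle_def)

lemma socle_closed: "z \<in> socle \<Longrightarrow> z \<in> carrier G"
  by (simp add: socle_centre centre_closed)

lemma socle_inv: "z \<in> socle \<Longrightarrow> inv z = z"
  by (simp add: inv_equality socle_square socle_closed)

lemma socle_one [simp]: "\<one> \<in> socle"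
  by (simp add: socle_def centre_def)

lemma socle_comm: "\<lbrakk>z \<in> socle; x \<in> carrier G\<rbrakk> \<Longrightarrow> z \<otimes> x = x \<otimes> z"
  by (simp add: centre_comm socle_centre)

lemma socle_left_comm:
  "\<lbrakk>z \<in> socle; x \<in> carrier G; y \<in> carrier G\<rbrakk> \<Longrightarrow> x \<otimes> (z \<otimes> y) = z \<otimes> (x \<otimes> y)"
  by (rule centre_left_comm[OF socle_centre])

lemma socle_mult: "\<lbrakk>a \<in> socle; b \<in> socle\<rbrakk> \<Longrightarrow> a \<otimes> b \<in> socle"
proof -
  assume a: "a \<in> socle" and b: "b \<in> socle"
  have "a \<otimes> b \<otimes> (a \<otimes> b) = (a \<otimes> a) \<otimes> (b \<otimes> b)"
    using a b by (simp add: m_assoc socle_closed socle_left_comm[OF a, of b b])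
  then show ?thesis
    using a b by (simp add: socle_def centre_mult)
qed

lemma socle_cancel: "\<lbrakk>a \<in> socle; x \<in> carrier G\<rbrakk> \<Longrightarrow> a \<otimes> (a \<otimes> x) = x"
  by (simp flip: m_assoc add: socle_square socle_closed)

lemma socle_hom_socle: "\<lbrakk>socle_hom h; x \<in> carrier G\<rbrakk> \<Longrightarrow> h x \<in> socle"
  and socle_hom_mult: "\<lbrakk>socle_hom h; x \<in> carrier G; y \<in> carrier G\<rbrakk> \<Longrightarrow> h (x \<otimes> y) = h x \<otimes> h y"
  by (simp_all add: socle_hom_def)

lemma socle_hom_closed: "\<lbrakk>socle_hom h; x \<in> carrier G\<rbrakk> \<Longrightarrow> h x \<in> carrier G"
  by (simp add: socle_closed socle_hom_socle)

lemma socle_hom_one: "socle_hom h \<Longrightarrow> h \<one> = \<one>"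
  using socle_hom_mult[of h \<one> \<one>] socle_hom_closed[of h \<one>] by simp

lemma socle_hom_inv: "\<lbrakk>socle_hom h; x \<in> carrier G\<rbrakk> \<Longrightarrow> h (inv x) = h x"
proof -
  assume h: "socle_hom h" and x: "x \<in> carrier G"
  have "h (inv x) \<otimes> h x = \<one>"
    using socle_hom_mult[OF h, of "inv x" x] socle_hom_one[OF h] x by simp
  then have "inv (h x) = h (inv x)"
    using h x by (simp add: inv_equality socle_hom_closed)
  then show "h (inv x) = h x"
    using socle_inv[OF socle_hom_socle[OF h x]] by simp
qed

text \<open>A square is sent to the square of a socle element, which is trivial. This is why
  socle-valued homomorphisms vanish on \<open>index_two_core\<close>.\<close>

lemma socle_hom_kernel:
  assumes h: "socle_hom h" shows "square_subgroup {x \<in> carrier G. h x = \<one>}"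
proof -
  have "subgroup {x \<in> carrier G. h x = \<one>} G"
  proof (rule subgroupI)
    have "\<one> \<in> {x \<in> carrier G. h x = \<one>}" using socle_hom_one[OF h] by simp
    then show "{x \<in> carrier G. h x = \<one>} \<noteq> {}" by blast
  qed (auto simp: socle_hom_mult[OF h] socle_hom_inv[OF h])
  then show ?thesis
    by (simp add: square_subgroup_def socle_hom_mult[OF h] socle_square[OF socle_hom_socle[OF h]])
qed

lemma index_two_core_closed: "x \<in> index_two_core \<Longrightarrow> x \<in> carrier G"
  by (simp add: index_two_core_def)

lemma frattini_index_two_core: "x \<in> frattini G \<Longrightarrow> x \<in> index_two_core"
  using frattini_subset_index_le_two by (auto simp: index_two_core_def frattini_def)

lemma index_two_core_subset:
  assumes "finite (carrier G)" "square_subgroup H" shows "index_two_core \<subseteq> H"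
proof
  fix x assume x: "x \<in> index_two_core"
  show "x \<in> H"
  proof (rule ccontr)
    assume "x \<notin> H"
    then obtain N where "index_le_two N" "x \<notin> N"
      using index_le_two_separation[OF assms index_two_core_closed[OF x]] by metis
    then show False using x by (simp add: index_two_core_def)
  qed
qed

lemma socle_hom_index_two_core:
  "\<lbrakk>finite (carrier G); socle_hom h; x \<in> index_two_core\<rbrakk> \<Longrightarrow> h x = \<one>"
  using index_two_core_subset[OF _ socle_hom_kernel] by blast

lemma index_two_core_mult:
  "\<lbrakk>x \<in> index_two_core; y \<in> index_two_core\<rbrakk> \<Longrightarrow> x \<otimes> y \<in> index_two_core"
  by (simp add: index_two_core_def index_le_two_mult)

lemma commutator_index_two_core:
  assumes "x \<in> carrier G" "y \<in> carrier G" shows "commutator x y \<in> index_two_core"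
  using assms by (simp add: index_two_core_def commutator_def index_le_two_mult index_le_two_inv) blast

lemma socle_hom_index_le_two:
  "\<lbrakk>index_le_two N; t \<in> socle\<rbrakk> \<Longrightarrow> socle_hom (\<lambda>x. if x \<in> N then \<one> else t)"
  by (auto simp: socle_hom_def index_le_two_mult socle_closed socle_square)

lemma socle_hom_prod:
  assumes g: "socle_hom g" and h: "socle_hom h" shows "socle_hom (\<lambda>x. g x \<otimes> h x)"
proof -
  have "g x \<otimes> g y \<otimes> (h x \<otimes> h y) = g x \<otimes> h x \<otimes> (g y \<otimes> h y)"
    if "x \<in> carrier G" "y \<in> carrier G" for x y
    using that socle_left_comm[of "h x" "g y" "h y"] socle_hom_socle[OF h]
    by (simp add: m_assoc socle_hom_closed[OF g] socle_hom_closed[OF h])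
  then show ?thesis
    using g h by (simp add: socle_hom_def socle_mult)
qed

section \<open>Elements whose commutators lie in the socle\<close>

lemma socle_lift_closed: "b \<in> socle_lift \<Longrightarrow> b \<in> carrier G"
  by (simp add: socle_lift_def)

lemma commutator_socle: "\<lbrakk>b \<in> socle_lift; x \<in> carrier G\<rbrakk> \<Longrightarrow> commutator b x \<in> socle"
  by (simp add: socle_lift_def)

lemma commutator_socle_lift_swap:
  "\<lbrakk>b \<in> socle_lift; x \<in> carrier G\<rbrakk> \<Longrightarrow> commutator x b = commutator b x"
  using inv_commutator[of b x] socle_inv[OF commutator_socle[of b x]] by (simp add: socle_lift_closed)

lemma socle_hom_commutator:
  assumes b: "b \<in> socle_lift" shows "socle_hom (commutator b)"
proof -
  have "y \<otimes> commutator b x \<otimes> inv y = commutator b x" if "x \<in> carrier G" "y \<in> carrier G" for x y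
    using that b by (simp add: socle_comm[OF commutator_socle, symmetric] m_assoc socle_lift_closed)
  then show ?thesis
    using b by (simp add: socle_hom_def commutator_socle commutator_mult_right socle_lift_closed)
qed

text \<open>Conjugation by \<open>b\<close> fixes the central element \<open>commutator c x\<close>,
  which turns the general commutator identity into linearity in the first argument.\<close>

lemma commutator_socle_lift_mult:
  assumes b: "b \<in> carrier G" and c: "c \<in> socle_lift" and x: "x \<in> carrier G"
  shows "commutator (b \<otimes> c) x = commutator b x \<otimes> commutator c x"
proof -
  have "b \<otimes> commutator c x \<otimes> inv b = commutator c x"
    using assms socle_comm[OF commutator_socle[OF c x] b, symmetric]
    by (simp add: m_assoc socle_lift_closed)
  then have "commutator (b \<otimes> c) x = commutator c x \<otimes> commutator b x"
    using assms by (simp add: commutator_mult_left socle_lift_closed)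
  then show ?thesis
    using socle_comm[OF commutator_socle[OF c x], of "commutator b x"] b x by simp
qed

lemma socle_lift_subgroup: "subgroup socle_lift G"
proof (rule subgroupI)
  have "\<one> \<in> socle_lift" by (simp add: socle_lift_def commutator_def)
  then show "socle_lift \<noteq> {}" by blast
  fix a assume a: "a \<in> socle_lift"
  have "commutator (inv a) x \<in> socle" if x: "x \<in> carrier G" for x
  proof -
    have "commutator (inv a \<otimes> a) x = commutator (inv a) x \<otimes> commutator a x"
      using a x by (intro commutator_socle_lift_mult) (auto simp: socle_lift_closed)
    moreover have "commutator (inv a \<otimes> a) x = \<one>"
      using a x by (simp add: commutator_def socle_lift_closed m_assoc)
    ultimately have "commutator (inv a) x = inv (commutator a x)"
      using a x by (simp add: inv_equality socle_lift_closed)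
    then show ?thesis using a x by (simp add: commutator_socle socle_inv)
  qed
  then show "inv a \<in> socle_lift" using a by (simp add: socle_lift_def)
  fix b assume b: "b \<in> socle_lift"
  show "a \<otimes> b \<in> socle_lift"
    using a b unfolding socle_lift_def
    by (auto simp: commutator_socle_lift_mult[OF _ b] socle_mult)
qed (simp add: socle_lift_def)

lemma socle_lift_mult: "\<lbrakk>a \<in> socle_lift; b \<in> socle_lift\<rbrakk> \<Longrightarrow> a \<otimes> b \<in> socle_lift"
  using subgroup.m_closed[OF socle_lift_subgroup] .

lemma socle_lift_inv: "a \<in> socle_lift \<Longrightarrow> inv a \<in> socle_lift"
  using subgroup.m_inv_closed[OF socle_lift_subgroup] .

lemma commutator_socle_lift_inv:
  assumes a: "a \<in> socle_lift" and x: "x \<in> carrier G"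
  shows "commutator (inv a) x = commutator a x"
proof -
  have "commutator (inv a) x = commutator x (inv a)"
    using commutator_socle_lift_swap[OF socle_lift_inv[OF a] x] by simp
  have "commutator (a \<otimes> inv a) x = commutator a x \<otimes> commutator (inv a) x"
    using a x by (intro commutator_socle_lift_mult) (auto simp: socle_lift_closed socle_lift_inv)
  moreover have "commutator (a \<otimes> inv a) x = \<one>"
    using a x by (simp add: commutator_def socle_lift_closed m_assoc)
  ultimately have "commutator a x = inv (commutator (inv a) x)"
    using a x by (simp add: inv_equality socle_lift_closed)
  then show ?thesis using a x by (simp add: commutator_socle socle_inv socle_lift_inv)
qed

lemma centre_socle_lift: "z \<in> centre \<Longrightarrow> z \<in> socle_lift"
  by (simp add: socle_lift_def centre_closed centre_comm commutator_eq_one_iff[THEN iffD2])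

lemma commutator_centre: "\<lbrakk>z \<in> centre; x \<in> carrier G\<rbrakk> \<Longrightarrow> commutator z x = \<one>"
  by (simp add: centre_closed centre_comm commutator_eq_one_iff)

lemma centre_if_commutator: "\<lbrakk>a \<in> carrier G; \<And>x. x \<in> carrier G \<Longrightarrow> commutator a x = \<one>\<rbrakk> \<Longrightarrow> a \<in> centre"
  by (simp add: centre_def commutator_eq_one_iff)

text \<open>By linearity [b^2, x] = [b, x]^2 = 1.\<close>

lemma socle_lift_square_centre: "b \<in> socle_lift \<Longrightarrow> b \<otimes> b \<in> centre"
  by (rule centre_if_commutator)
     (simp_all add: commutator_socle_lift_mult socle_lift_closed commutator_socle socle_square)

section \<open>The centre modulo squares\<close>

definition square_class :: "'a \<Rightarrow> 'a set" where
  "square_class p = (\<lambda>z. z \<otimes> z \<otimes> p) ` centre"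

text \<open>Squaring on the centre has kernel \<open>socle\<close>, so the index of its image is
  \<open>card socle\<close>; the square classes of central elements are the cosets of that
  image.\<close>

lemma card_square_class:
  assumes fin: "finite (carrier G)"
  shows "card (square_class ` centre) = card socle"
proof -
  interpret Z: comm_group "G\<lparr>carrier := centre\<rparr>" by (rule centre_comm_group)
  let ?Q = "(\<lambda>z. z \<otimes> z) ` centre"
  have "subgroup ?Q (G\<lparr>carrier := centre\<rparr>)"
  proof (rule Z.subgroupI)
    fix a assume "a \<in> ?Q"
    then obtain x where x: "x \<in> centre" "a = x \<otimes> x" by blast
    then have "inv\<^bsub>G\<lparr>carrier := centre\<rparr>\<^esub> a = inv x \<otimes> inv x"
      using m_inv_consistent[OF centre_subgroup] by (simp add: centre_mult centre_closed inv_mult_group)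
    then show "inv\<^bsub>G\<lparr>carrier := centre\<rparr>\<^esub> a \<in> ?Q" using x by (simp add: centre_inv)
  next
    fix a b assume "a \<in> ?Q" "b \<in> ?Q"
    then obtain x y where "x \<in> centre" "a = x \<otimes> x" "y \<in> centre" "b = y \<otimes> y" by blast
    moreover from this have "x \<otimes> x \<otimes> (y \<otimes> y) = x \<otimes> y \<otimes> (x \<otimes> y)"
      by (simp add: m_assoc centre_closed centre_left_comm)
    ultimately show "a \<otimes>\<^bsub>G\<lparr>carrier := centre\<rparr>\<^esub> b \<in> ?Q" by (simp add: centre_mult)
  qed (use subgroup.one_closed[OF centre_subgroup] in \<open>auto simp: centre_mult\<close>)
  moreover have "rcosets\<^bsub>G\<lparr>carrier := centre\<rparr>\<^esub> ?Q = square_class ` centre"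
    by (auto simp: RCOSETS_def r_coset_def square_class_def)
  ultimately have "card (square_class ` centre) * card ?Q = card centre"
    using Z.lagrange[of ?Q] by (simp add: order_def)
  moreover have "card socle * card ?Q = card centre"
    using Z.card_square_fibres finite_subset[OF subgroup.subset[OF centre_subgroup] fin]
    by (simp add: socle_def)
  moreover have "card ?Q > 0"
    using subgroup.one_closed[OF centre_subgroup] finite_subset[OF subgroup.subset[OF centre_subgroup] fin]
    by (auto simp: card_gt_0_iff)
  ultimately show ?thesis by (metis mult_right_cancel less_not_refl)
qed

lemma square_class_eqD:
  assumes "square_class p = square_class q" "p \<in> carrier G"
  obtains z where "z \<in> centre" "p = z \<otimes> z \<otimes> q"
proof -
  have "p \<in> square_class p"
    using assms(2) subgroup.one_closed[OF centre_subgroup] by (force simp: square_class_def)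
  then show thesis using assms that by (auto simp: square_class_def)
qed

end

text \<open>The setting of the proof by contradiction, phrased for plain functions so that only
  their values on the carrier matter. The nontrivial element in \<open>core_socle\<close> will come
  from the last nontrivial term of the lower central series.\<close>

locale inner_frattini_involutions = group G for G (structure) +
  assumes fin: "finite (carrier G)"
    and inner: "\<And>f. \<lbrakk>\<And>x. x \<in> carrier G \<Longrightarrow> f x \<in> carrier G;
        \<And>x y. \<lbrakk>x \<in> carrier G; y \<in> carrier G\<rbrakk> \<Longrightarrow> f (x \<otimes> y) = f x \<otimes> f y;
        \<And>x. x \<in> carrier G \<Longrightarrow> f (f x) = x;
        \<And>x. x \<in> frattini G \<Longrightarrow> f x = x\<rbrakk>
      \<Longrightarrow> \<exists>c\<in>carrier G. \<forall>x\<in>carrier G. f x = c \<otimes> x \<otimes> inv c"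
    and core_socle: "\<exists>t\<in>socle \<inter> index_two_core. t \<noteq> \<one>"
begin

text \<open>Since c x c^-1 = [c, x] x, endomorphisms x \<mapsto> d(x) x correspond to derivations
  \<open>d\<close>. The condition \<open>invol\<close> says that the map squares to the identity,
  and triviality on the core makes it fix \<open>frattini G\<close>.\<close>

lemma inner_derivation:
  assumes closed: "\<And>x. x \<in> carrier G \<Longrightarrow> d x \<in> carrier G"
    and mult: "\<And>x y. \<lbrakk>x \<in> carrier G; y \<in> carrier G\<rbrakk> \<Longrightarrow> d (x \<otimes> y) = d x \<otimes> (x \<otimes> d y \<otimes> inv x)"
    and invol: "\<And>x. x \<in> carrier G \<Longrightarrow> d (d x \<otimes> x) \<otimes> d x = \<one>"
    and core: "\<And>x. x \<in> index_two_core \<Longrightarrow> d x = \<one>"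
  obtains c where "c \<in> carrier G" "\<And>x. x \<in> carrier G \<Longrightarrow> commutator c x = d x"
proof -
  have "\<exists>c\<in>carrier G. \<forall>x\<in>carrier G. d x \<otimes> x = c \<otimes> x \<otimes> inv c"
  proof (rule inner)
    show "d (d x \<otimes> x) \<otimes> (d x \<otimes> x) = x" if "x \<in> carrier G" for x
      using that invol[OF that] closed m_assoc[of "d (d x \<otimes> x)" "d x" x] by simp
    show "d x \<otimes> x = x" if "x \<in> frattini G" for x
      using that core[of x] frattini_index_two_core[OF that] index_two_core_closed[of x] by simp
  qed (auto simp: closed mult m_assoc)
  then obtain c where c: "c \<in> carrier G" "\<And>x. x \<in> carrier G \<Longrightarrow> d x \<otimes> x = c \<otimes> x \<otimes> inv c" by blast
  have "commutator c x = d x" if x: "x \<in> carrier G" for x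
    using c(2)[OF x, symmetric] x closed by (simp add: commutator_def m_assoc)
  then show thesis using that c by blast
qed

text \<open>If \<open>N\<close> misses a central \<open>z\<close>, multiply all elements outside
  \<open>N\<close> by a nontrivial \<open>t\<close> of the socle that lies in the core. As
  \<open>t\<close> is in \<open>N\<close>, this is an involution; it moves the central element
  \<open>z\<close>, so it cannot be inner.\<close>

lemma centre_core: assumes z: "z \<in> centre" shows "z \<in> index_two_core"
  unfolding index_two_core_def
proof (safe intro!: centre_closed z, rule ccontr)
  fix N assume N: "index_le_two N" "z \<notin> N"
  obtain t where t: "t \<in> socle" "t \<in> index_two_core" "t \<noteq> \<one>" using core_socle by blast
  let ?d = "\<lambda>x. if x \<in> N then \<one> else t"
  have tN: "t \<in> N" using t N by (simp add: index_two_core_def)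
  obtain c where c: "c \<in> carrier G" "\<And>x. x \<in> carrier G \<Longrightarrow> commutator c x = ?d x"
  proof (rule inner_derivation[of ?d])
    fix x y assume xy: "x \<in> carrier G" "y \<in> carrier G"
    have "x \<otimes> t \<otimes> inv x = t"
      using xy t socle_comm[of t x, symmetric] by (simp add: m_assoc socle_closed)
    then show "?d (x \<otimes> y) = ?d x \<otimes> (x \<otimes> ?d y \<otimes> inv x)"
      using xy t by (auto simp: index_le_two_mult[OF N(1)] socle_closed socle_square)
  next
    fix x assume "x \<in> carrier G"
    then show "?d (?d x \<otimes> x) \<otimes> ?d x = \<one>"
      using t tN index_le_two_one[OF N(1)]
      by (auto simp: index_le_two_mult[OF N(1)] socle_closed socle_square)
  qed (use t N in \<open>auto simp: socle_closed index_two_core_def\<close>)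
  have "commutator c z = \<one>"
    using c(1) z by (simp add: commutator_eq_one_iff centre_closed centre_comm[OF z])
  then show False using c(2)[of z] N t z by (simp add: centre_closed)
qed

lemma socle_core: "z \<in> socle \<Longrightarrow> z \<in> index_two_core"
  by (simp add: centre_core socle_centre)

lemma socle_hom_on_core: "\<lbrakk>socle_hom h; x \<in> index_two_core\<rbrakk> \<Longrightarrow> h x = \<one>"
  by (rule socle_hom_index_two_core[OF fin])

text \<open>A homomorphism into the centre is a derivation. It vanishes on its own values because
  the socle lies in the core, so the automorphism it defines squares to the identity.\<close>

lemma socle_hom_realised:
  assumes h: "socle_hom h"
  obtains b where "b \<in> socle_lift" "\<And>x. x \<in> carrier G \<Longrightarrow> commutator b x = h x"
proof -
  obtain c where c: "c \<in> carrier G" "\<And>x. x \<in> carrier G \<Longrightarrow> commutator c x = h x"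
  proof (rule inner_derivation[of h])
    fix x y assume xy: "x \<in> carrier G" "y \<in> carrier G"
    have "x \<otimes> h y \<otimes> inv x = h y"
      using xy socle_comm[OF socle_hom_socle[OF h], of y x, symmetric]
      by (simp add: m_assoc socle_hom_closed[OF h])
    then show "h (x \<otimes> y) = h x \<otimes> (x \<otimes> h y \<otimes> inv x)" using xy h by (simp add: socle_hom_mult)
  next
    fix x assume x: "x \<in> carrier G"
    have "h (h x) = \<one>" by (intro socle_hom_on_core h socle_core socle_hom_socle x)
    then show "h (h x \<otimes> x) \<otimes> h x = \<one>"
      using x by (simp add: socle_hom_mult[OF h] socle_hom_closed[OF h] socle_square[OF socle_hom_socle[OF h]])
  qed (use h socle_hom_on_core in \<open>auto simp: socle_hom_closed\<close>)
  then have "c \<in> socle_lift" by (simp add: socle_lift_def socle_hom_socle[OF h])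
  then show thesis using that c by blast
qed

text \<open>Exchanging \<open>u\<close> and \<open>v\<close> while fixing all elements that commute
  with both is an involution trivial on the core. If it were conjugation by \<open>c\<close>, then
  [c, u] = v u^-1 would be central, yet it does not commute with \<open>u\<close>.\<close>

lemma no_equal_squares:
  assumes soc: "socle = {\<one>, t}" and t: "t \<noteq> \<one>"
    and u: "u \<in> socle_lift" and v: "v \<in> socle_lift" and uv: "commutator u v = t"
    and sq: "u \<otimes> u = v \<otimes> v"
  shows False
proof -
  have ts: "t \<in> socle" using soc by simp
  have uc: "u \<in> carrier G" and vc: "v \<in> carrier G" and tc: "t \<in> carrier G"
    using u v ts by (simp_all add: socle_lift_closed socle_closed)
  define w where "w = u \<otimes> inv v"
  have w: "w \<in> socle_lift" using u v by (simp add: w_def socle_lift_mult socle_lift_inv)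
  have wc: "w \<in> carrier G" using w by (rule socle_lift_closed)
  define a where "a = commutator u"
  define b where "b = commutator v"
  have a: "socle_hom a" and b: "socle_hom b"
    using u v by (simp_all add: a_def b_def socle_hom_commutator)
  have tt: "t \<otimes> t = \<one>" using ts by (rule socle_square)
  have ttx: "t \<otimes> (t \<otimes> x) = x" if "x \<in> carrier G" for x
    using socle_cancel[OF ts that] .
  have tcomm: "x \<otimes> t = t \<otimes> x" if "x \<in> carrier G" for x
    using socle_comm[OF ts that] by simp
  have tlcomm: "x \<otimes> (t \<otimes> y) = t \<otimes> (x \<otimes> y)" if "x \<in> carrier G" "y \<in> carrier G" for x y
    using socle_left_comm[OF ts that] .
  have vals: "a x = \<one> \<or> a x = t" "b x = \<one> \<or> b x = t" if "x \<in> carrier G" for x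
    using socle_hom_socle[OF a that] socle_hom_socle[OF b that] soc by auto
  have au: "a u = \<one>" and bv: "b v = \<one>" using uc vc by (simp_all add: a_def b_def commutator_eq_one_iff)
  have av: "a v = t" by (simp add: a_def uv)
  have bu: "b u = t" using commutator_socle_lift_swap[OF u vc] uv by (simp add: b_def)
  have aw: "a w = t" and bw: "b w = t"
    using uc vc tc by (simp_all add: w_def socle_hom_mult[OF a] socle_hom_mult[OF b]
        socle_hom_inv[OF a] socle_hom_inv[OF b] au av bu bv)
  have at: "a t = \<one>" and bt: "b t = \<one>"
    using socle_hom_on_core socle_core ts a b by blast+
  \<comment> \<open>Conjugation by \<open>x\<close> multiplies \<open>w\<close> by [u, x] [v, x],
    and the two factors cancel when they agree.\<close>
  have conjw: "x \<otimes> w \<otimes> inv x = (if a x = b x then w else t \<otimes> w)" if x: "x \<in> carrier G" for x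
  proof -
    have "commutator w x = a x \<otimes> b x"
      using commutator_socle_lift_mult[OF uc socle_lift_inv[OF v] x] commutator_socle_lift_inv[OF v x]
      by (simp add: w_def a_def b_def)
    then have k: "commutator x w = a x \<otimes> b x"
      using commutator_socle_lift_swap[OF w x] by simp
    have "x \<otimes> w \<otimes> inv x = commutator x w \<otimes> w"
      using x wc by (simp add: commutator_def m_assoc)
    then have "x \<otimes> w \<otimes> inv x = a x \<otimes> b x \<otimes> w" by (simp only: k)
    then show ?thesis
      using vals[OF x] wc tc t tt by (elim disjE) simp_all
  qed
  \<comment> \<open>Moving the middle \<open>u\<close> past \<open>inv v\<close> gives w^2 = t u^2
    v^-2, and the squares cancel.\<close>
  have ww: "w \<otimes> w = t"
  proof -
    have "inv v \<otimes> u = t \<otimes> (u \<otimes> inv v)"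
      using mult_eq_commutator[of "inv v" u] commutator_socle_lift_inv[OF v uc] bu uc vc by (simp add: b_def)
    then have "w \<otimes> w = u \<otimes> (t \<otimes> (u \<otimes> inv v)) \<otimes> inv v"
      using uc vc m_assoc[of u "inv v \<otimes> u" "inv v"] m_assoc[of u "inv v" u]
      by (simp add: w_def flip: m_assoc)
    also have "\<dots> = t \<otimes> ((u \<otimes> u) \<otimes> inv v \<otimes> inv v)"
      using uc vc tc by (simp add: m_assoc tlcomm)
    also have "\<dots> = t" unfolding sq using uc vc tc by (simp add: m_assoc)
    finally show ?thesis .
  qed
  have wwx: "w \<otimes> (w \<otimes> x) = t \<otimes> x" if "x \<in> carrier G" for x
    using that wc by (simp flip: m_assoc add: ww)
  \<comment> \<open>The derivation of the automorphism that exchanges \<open>u\<close> and \<open>v\<close> and is trivial on the elements commuting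
    with both.\<close>
  define d where "d x = (if a x = \<one> then if b x = \<one> then \<one> else t \<otimes> w
      else if b x = \<one> then w else t)" for x
  note closed = uc vc tc wc
  note grp = m_assoc tt ttx tcomm[OF wc] tlcomm[OF wc] ww wwx
  have conjt: "x \<otimes> t \<otimes> inv x = t" if "x \<in> carrier G" for x
    using that tc by (simp add: tcomm m_assoc)
  have conjtw: "x \<otimes> (t \<otimes> w) \<otimes> inv x = t \<otimes> (x \<otimes> w \<otimes> inv x)" if "x \<in> carrier G" for x
    using that tc wc by (simp add: tlcomm m_assoc)
  obtain c where c: "c \<in> carrier G" "\<And>x. x \<in> carrier G \<Longrightarrow> commutator c x = d x"
  proof (rule inner_derivation[of d])
    fix x y assume xy: "x \<in> carrier G" "y \<in> carrier G"
    have "x \<otimes> d y \<otimes> inv x = (if a y = \<one> then if b y = \<one> then \<one> else t \<otimes> (x \<otimes> w \<otimes> inv x)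
      else if b y = \<one> then x \<otimes> w \<otimes> inv x else t)"
      using xy by (simp add: d_def conjt conjtw)
    then show "d (x \<otimes> y) = d x \<otimes> (x \<otimes> d y \<otimes> inv x)"
      unfolding conjw[OF xy(1)] using vals[OF xy(1)] vals[OF xy(2)] t closed
      by (elim disjE) (simp_all add: d_def xy socle_hom_mult[OF a] socle_hom_mult[OF b] grp)
  next
    fix x assume x: "x \<in> carrier G"
    show "d (d x \<otimes> x) \<otimes> d x = \<one>"
      using vals[OF x] t closed
      by (elim disjE) (simp_all add: d_def x socle_hom_mult[OF a] socle_hom_mult[OF b] grp at bt aw bw)
  next
    show "d x = \<one>" if "x \<in> index_two_core" for x
      using that by (simp add: d_def socle_hom_on_core[OF a] socle_hom_on_core[OF b])
    show "d x \<in> carrier G" for x using closed by (simp add: d_def)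
  qed blast
  \<comment> \<open>As \<open>u\<close> is in \<open>socle_lift\<close>, this commutator lies in the
    socle and is killed by \<open>a\<close>, whereas \<open>a\<close> sends
    \<open>t \<otimes> w\<close> to \<open>t\<close>.\<close>
  have "t \<otimes> w = commutator c u" using c(2)[OF uc] t by (simp add: d_def au bu)
  also have "\<dots> \<in> socle"
    using commutator_socle_lift_swap[OF u c(1)] commutator_socle[OF u c(1)] by simp
  finally have "a (t \<otimes> w) = \<one>" by (intro socle_hom_on_core a socle_core)
  then show False using t closed by (simp add: socle_hom_mult[OF a] at aw)
qed

text \<open>Choose \<open>c\<close> whose commutator form has kernel \<open>N\<close> and values in
  {1, t}, so that [c, b] = t. If the socle has a third element \<open>r\<close>, some
  \<open>e\<close> has [e, c] = r, although [c, e] is 1 or \<open>t\<close>. Otherwise Z has only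
  two square classes, so two of b^2, c^2, (b c)^2 share a class and \<open>no_equal_squares\<close>
  applies.\<close>

lemma socle_lift_core:
  assumes b: "b \<in> socle_lift" shows "b \<in> index_two_core"
  unfolding index_two_core_def
proof (safe intro!: socle_lift_closed b, rule ccontr)
  fix N assume N: "index_le_two N" "b \<notin> N"
  note bc = socle_lift_closed[OF b]
  obtain t where t: "t \<in> socle" "t \<noteq> \<one>" using core_socle by blast
  have char: "\<exists>c\<in>socle_lift. \<forall>x\<in>carrier G. commutator c x = (if x \<in> N' then \<one> else r)"
    if "index_le_two N'" "r \<in> socle" for N' r
    using socle_hom_realised[OF socle_hom_index_le_two[OF that]] by metis
  obtain c where c: "c \<in> socle_lift" "\<And>x. x \<in> carrier G \<Longrightarrow> commutator c x = (if x \<in> N then \<one> else t)"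
    using char[OF N(1) t(1)] by blast
  note cc = socle_lift_closed[OF c(1)]
  have cb: "commutator c b = t" using c(2)[OF bc] N by simp
  show False
  proof (cases "socle = {\<one>, t}")
    case False
    then obtain r where r: "r \<in> socle" "r \<noteq> \<one>" "r \<noteq> t" using t socle_one by blast
    have "commutator b c \<noteq> \<one>" using commutator_socle_lift_swap[OF b cc] cb t by simp
    then have "c \<notin> index_two_core"
      using socle_hom_on_core[OF socle_hom_commutator[OF b]] by blast
    then obtain N' where N': "index_le_two N'" "c \<notin> N'" using cc by (auto simp: index_two_core_def)
    obtain e where e: "e \<in> socle_lift" "\<And>x. x \<in> carrier G \<Longrightarrow> commutator e x = (if x \<in> N' then \<one> else r)"
      using char[OF N'(1) r(1)] by blast
    have "commutator c e = r"
      using commutator_socle_lift_swap[OF e(1) cc] e(2)[OF cc] N' by simp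
    then show False using c(2)[OF socle_lift_closed[OF e(1)]] r by (simp split: if_splits)
  next
    case True
    have two: "card socle = 2" using True t by simp
    \<comment> \<open>Absorbing a central factor \<open>z\<close> into \<open>v\<close> makes the
      squares equal and leaves the commutator unchanged.\<close>
    have clash: False if u: "u \<in> socle_lift" and v: "v \<in> socle_lift" and uv: "commutator u v = t"
      and cl: "square_class (u \<otimes> u) = square_class (v \<otimes> v)" for u v
    proof -
      obtain z where z: "z \<in> centre" "u \<otimes> u = z \<otimes> z \<otimes> (v \<otimes> v)"
        using square_class_eqD[OF cl] socle_lift_closed[OF u] by blast
      show False
      proof (rule no_equal_squares[OF True t(2) u])
        note zc = centre_closed[OF z(1)]
        show "z \<otimes> v \<in> socle_lift" using z v by (simp add: socle_lift_mult centre_socle_lift)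
        have "commutator (z \<otimes> v) u = commutator v u"
          using u v z zc by (simp add: commutator_socle_lift_mult socle_lift_closed commutator_centre)
        then show "commutator u (z \<otimes> v) = t"
          using uv u v \<open>z \<otimes> v \<in> socle_lift\<close> by (simp add: commutator_socle_lift_swap socle_lift_closed)
        show "u \<otimes> u = z \<otimes> v \<otimes> (z \<otimes> v)"
          using z zc socle_lift_closed[OF v] by (simp add: m_assoc centre_left_comm)
      qed
    qed
    let ?cl = "\<lambda>x. square_class (x \<otimes> x)"
    have bc': "b \<otimes> c \<in> socle_lift" using b c by (simp add: socle_lift_mult)
    have "commutator b c = t" using commutator_socle_lift_swap[OF b cc] cb by simp
    moreover have "commutator b b = \<one>" "commutator c c = \<one>"
      using bc cc by (simp_all add: commutator_eq_one_iff)
    ultimately have cbc: "commutator c (b \<otimes> c) = t" "commutator b (b \<otimes> c) = t"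
      using socle_hom_mult[OF socle_hom_commutator[OF b] bc cc]
        socle_hom_mult[OF socle_hom_commutator[OF c(1)] bc cc] cb t(1)
      by (simp_all add: socle_closed)
    have "?cl c \<noteq> ?cl b" "?cl c \<noteq> ?cl (b \<otimes> c)" "?cl b \<noteq> ?cl (b \<otimes> c)"
      using clash[OF c(1) b cb] clash[OF c(1) bc' cbc(1)] clash[OF b bc' cbc(2)] by blast+
    then have "card {?cl c, ?cl b, ?cl (b \<otimes> c)} = 3" by simp
    moreover have "{?cl c, ?cl b, ?cl (b \<otimes> c)} \<subseteq> square_class ` centre"
      using b c bc' socle_lift_square_centre by auto
    moreover have "finite (square_class ` centre)"
      using card_square_class[OF fin] two by (simp add: card_ge_0_finite)
    ultimately show False
      using card_mono[of "square_class ` centre" "{?cl c, ?cl b, ?cl (b \<otimes> c)}"] card_square_class[OF fin] two by simp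
  qed
qed

end

section \<open>Quadratic maps into the socle\<close>

context group
begin

section \<open>Square roots modulo a normal subgroup\<close>

lemma comm_group_Mod:
  assumes N: "N \<lhd> G" and comm: "\<And>x y. \<lbrakk>x \<in> carrier G; y \<in> carrier G\<rbrakk> \<Longrightarrow> commutator x y \<in> N"
  shows "comm_group (G Mod N)"
proof (rule group.group_comm_groupI)
  interpret N: normal N G by (rule N)
  show "group (G Mod N)" by (rule N.factorgroup_is_group)
  fix U V assume "U \<in> carrier (G Mod N)" "V \<in> carrier (G Mod N)"
  then obtain x y where xy: "x \<in> carrier G" "y \<in> carrier G" "U = N #> x" "V = N #> y"
    by (auto simp: FactGroup_def RCOSETS_def)
  have "x \<otimes> y \<in> N #> (y \<otimes> x)"
    using mult_eq_commutator[OF xy(1,2)] comm[OF xy(1,2)] by (auto simp: r_coset_def)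
  then have "N #> (y \<otimes> x) = N #> (x \<otimes> y)"
    using xy by (intro repr_independence) (auto simp: N.subgroup_axioms)
  then show "U \<otimes>\<^bsub>G Mod N\<^esub> V = V \<otimes>\<^bsub>G Mod N\<^esub> U"
    using xy by (simp add: FactGroup_def N.rcos_sum)
qed

text \<open>The \<open>c i\<close> have distinct images in the abelian group G/N, each of order at
  most two, and G/N is generated by the image of \<open>S\<close>.\<close>

lemma card_square_roots_le:
  assumes fin: "finite (carrier G)" and S: "finite S" "S \<subseteq> carrier G" "generate G S = carrier G"
    and N: "N \<lhd> G" and comm: "\<And>x y. \<lbrakk>x \<in> carrier G; y \<in> carrier G\<rbrakk> \<Longrightarrow> commutator x y \<in> N"
    and c: "\<And>i. i \<in> I \<Longrightarrow> c i \<in> carrier G" "\<And>i. i \<in> I \<Longrightarrow> c i \<otimes> c i \<in> N"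
    and inj: "\<And>i j k. \<lbrakk>i \<in> I; j \<in> I; k \<in> N; c i = k \<otimes> c j\<rbrakk> \<Longrightarrow> i = j"
  shows "card I \<le> 2 ^ card S"
proof -
  interpret N: normal N G by (rule N)
  interpret Q: comm_group "G Mod N" by (rule comm_group_Mod[OF N comm])
  interpret h: group_hom G "G Mod N" "\<lambda>a. N #> a"
    by (simp add: group_hom_def group_hom_axioms_def is_group Q.is_group N.r_coset_hom_Mod)
  have carr: "carrier (G Mod N) = (\<lambda>a. N #> a) ` carrier G"
    by (auto simp: FactGroup_def RCOSETS_def)
  have finQ: "finite (carrier (G Mod N))" using fin by (simp add: carr)
  have one: "\<one>\<^bsub>G Mod N\<^esub> = N" by (simp add: FactGroup_def)
  let ?T = "{U \<in> carrier (G Mod N). U \<otimes>\<^bsub>G Mod N\<^esub> U = \<one>\<^bsub>G Mod N\<^esub>}"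
  have "card ?T \<le> 2 ^ card ((\<lambda>a. N #> a) ` S)"
    using S finQ by (intro Q.card_involutions_le) (auto simp: h.generate_img carr)
  also have "\<dots> \<le> 2 ^ card S" using S by (simp add: card_image_le)
  finally have T: "card ?T \<le> 2 ^ card S" .
  have "inj_on (\<lambda>i. N #> c i) I"
  proof (rule inj_onI)
    fix i j assume ij: "i \<in> I" "j \<in> I" "N #> c i = N #> c j"
    then have "c i \<in> N #> c j" using N.subgroup_axioms c(1) rcos_self by metis
    then obtain k where "k \<in> N" "c i = k \<otimes> c j" by (auto simp: r_coset_def)
    then show "i = j" using inj ij by blast
  qed
  moreover have "(\<lambda>i. N #> c i) ` I \<subseteq> ?T"
  proof (intro image_subsetI CollectI conjI)
    fix i assume i: "i \<in> I"
    show "N #> c i \<in> carrier (G Mod N)" using c(1)[OF i] by (simp add: carr)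
    have "(N #> c i) \<otimes>\<^bsub>G Mod N\<^esub> (N #> c i) = N #> (c i \<otimes> c i)"
      using c(1)[OF i] by simp
    also have "\<dots> = N" by (rule coset_join2) (use c i N.subgroup_axioms in auto)
    finally show "(N #> c i) \<otimes>\<^bsub>G Mod N\<^esub> (N #> c i) = \<one>\<^bsub>G Mod N\<^esub>" by (simp add: one)
  qed
  ultimately have "card I \<le> card ?T" using finQ by (intro card_inj_on_le) auto
  then show ?thesis using T by simp
qed

section \<open>The second centre\<close>

definition second_centre :: "'a set" where
  "second_centre = {g \<in> carrier G. \<forall>x\<in>carrier G. commutator g x \<in> centre}"

lemma centre_conj: "\<lbrakk>z \<in> centre; x \<in> carrier G\<rbrakk> \<Longrightarrow> x \<otimes> z \<otimes> inv x = z"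
  using centre_left_comm[of z x "inv x"] by (simp add: centre_closed m_assoc)

lemma second_centre_normal: "second_centre \<lhd> G"
proof -
  have "subgroup second_centre G"
  proof (rule subgroupI)
    have "\<one> \<in> second_centre"
      by (simp add: second_centre_def commutator_def subgroup.one_closed[OF centre_subgroup])
    then show "second_centre \<noteq> {}" by blast
    fix a assume a: "a \<in> second_centre"
    then have ac: "a \<in> carrier G" by (simp add: second_centre_def)
    have "commutator (inv a) x \<in> centre" if x: "x \<in> carrier G" for x
    proof -
      have "commutator (inv a) x = inv a \<otimes> inv (commutator a x) \<otimes> inv (inv a)"
        using ac x by (simp add: commutator_def word_simps)
      also have "\<dots> = inv (commutator a x)"
        using a x ac by (intro centre_conj centre_inv) (auto simp: second_centre_def)
      finally show ?thesis using a x by (simp add: second_centre_def centre_inv)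
    qed
    then show "inv a \<in> second_centre" using ac by (simp add: second_centre_def)
    fix b assume b: "b \<in> second_centre"
    then show "a \<otimes> b \<in> second_centre"
      using a by (auto simp: second_centre_def commutator_mult_left centre_conj centre_mult)
  qed (auto simp: second_centre_def)
  moreover have "x \<otimes> h \<otimes> inv x \<in> second_centre" if x: "x \<in> carrier G" and h: "h \<in> second_centre" for x h
  proof -
    have hc: "h \<in> carrier G" "commutator h (inv x) \<in> centre" using x h by (auto simp: second_centre_def)
    \<comment> \<open>Conjugation changes \<open>h\<close> by a central factor, which further
      commutators ignore.\<close>
    have eq: "x \<otimes> h \<otimes> inv x = commutator x h \<otimes> h"
      using x hc by (simp add: commutator_def m_assoc)
    have "commutator x h = inv (commutator h x)" using x hc by (simp add: inv_commutator)
    then have z: "commutator x h \<in> centre" using x h by (simp add: second_centre_def centre_inv)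
    have "commutator (x \<otimes> h \<otimes> inv x) y = commutator h y" if y: "y \<in> carrier G" for y
      unfolding eq commutator_mult_left[OF centre_closed[OF z] hc(1) y]
      using z h y hc centre_conj[of "commutator h y" "commutator x h"]
      by (simp add: commutator_centre second_centre_def centre_closed)
    then show ?thesis using x h hc by (simp add: second_centre_def)
  qed
  ultimately show ?thesis by (simp add: normal_inv_iff)
qed

section \<open>Quadratic maps and their polar forms\<close>

definition polar :: "('a \<Rightarrow> 'a) \<Rightarrow> 'a \<Rightarrow> 'a \<Rightarrow> 'a" where
  "polar q x y = q (x \<otimes> y) \<otimes> q x \<otimes> q y"

text \<open>In a finite group such a map depends only on the class modulo the core: by
  \<open>quadratic_mult\<close>, a factor from the core contributes a trivial value and a trivial
  polar term.\<close>

definition quadratic :: "('a \<Rightarrow> 'a) \<Rightarrow> bool" where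
  "quadratic q \<longleftrightarrow> (\<forall>x\<in>carrier G. q x \<in> socle) \<and> (\<forall>x\<in>index_two_core. q x = \<one>) \<and>
     (\<forall>y\<in>carrier G. socle_hom (\<lambda>x. polar q x y) \<and> socle_hom (polar q y))"

lemma quadratic_socle: "\<lbrakk>quadratic q; x \<in> carrier G\<rbrakk> \<Longrightarrow> q x \<in> socle"
  and quadratic_core: "\<lbrakk>quadratic q; x \<in> index_two_core\<rbrakk> \<Longrightarrow> q x = \<one>"
  and polar_hom_left: "\<lbrakk>quadratic q; y \<in> carrier G\<rbrakk> \<Longrightarrow> socle_hom (\<lambda>x. polar q x y)"
  and polar_hom_right: "\<lbrakk>quadratic q; x \<in> carrier G\<rbrakk> \<Longrightarrow> socle_hom (polar q x)"
  by (simp_all add: quadratic_def)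

lemma quadratic_mult:
  assumes q: "quadratic q" and x: "x \<in> carrier G" and y: "y \<in> carrier G"
  shows "q (x \<otimes> y) = q x \<otimes> q y \<otimes> polar q x y"
proof -
  note soc = quadratic_socle[OF q x] quadratic_socle[OF q y]
  have qc: "q (x \<otimes> y) \<in> carrier G" "q x \<in> carrier G" "q y \<in> carrier G"
    using x y by (auto intro: socle_closed quadratic_socle[OF q])
  have "q x \<otimes> q y \<otimes> polar q x y = q x \<otimes> (q y \<otimes> (q (x \<otimes> y) \<otimes> (q x \<otimes> q y)))"
    using qc by (simp add: polar_def m_assoc)
  also have "q (x \<otimes> y) \<otimes> (q x \<otimes> q y) = (q x \<otimes> q y) \<otimes> q (x \<otimes> y)"
    using socle_comm[OF socle_mult[OF soc] qc(1)] by simp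
  also have "q y \<otimes> (q x \<otimes> q y \<otimes> q (x \<otimes> y)) = q x \<otimes> q (x \<otimes> y)"
    using qc socle_left_comm[OF soc(1) qc(3), of "q y \<otimes> q (x \<otimes> y)"] socle_cancel[OF soc(2) qc(1)]
    by (simp add: m_assoc)
  also have "q x \<otimes> (q x \<otimes> q (x \<otimes> y)) = q (x \<otimes> y)" by (rule socle_cancel[OF soc(1) qc(1)])
  finally show ?thesis ..
qed

lemma socle_interchange:
  assumes "a \<in> socle" "b \<in> socle" "c \<in> socle" "d \<in> socle"
  shows "a \<otimes> b \<otimes> (c \<otimes> d) = a \<otimes> c \<otimes> (b \<otimes> d)"
  using assms socle_left_comm[of c b d] by (simp add: m_assoc socle_closed)

lemma polar_prod:
  assumes q: "quadratic q" and r: "quadratic r" and x: "x \<in> carrier G" and y: "y \<in> carrier G"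
  shows "polar (\<lambda>x. q x \<otimes> r x) x y = polar q x y \<otimes> polar r x y"
  using x y
  by (simp add: polar_def socle_interchange socle_mult quadratic_socle[OF q] quadratic_socle[OF r])

lemma socle_hom_cong:
  "\<lbrakk>socle_hom g; \<And>x. x \<in> carrier G \<Longrightarrow> h x = g x\<rbrakk> \<Longrightarrow> socle_hom h"
  by (simp add: socle_hom_def)

lemma quadratic_prod:
  assumes q: "quadratic q" and r: "quadratic r"
  shows "quadratic (\<lambda>x. q x \<otimes> r x)"
proof -
  have "socle_hom (\<lambda>x. polar (\<lambda>x. q x \<otimes> r x) x y)" if y: "y \<in> carrier G" for y
    by (rule socle_hom_cong[OF socle_hom_prod[OF polar_hom_left[OF q y] polar_hom_left[OF r y]]])
      (simp add: polar_prod[OF q r _ y])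
  moreover have "socle_hom (polar (\<lambda>x. q x \<otimes> r x) y)" if y: "y \<in> carrier G" for y
    by (rule socle_hom_cong[OF socle_hom_prod[OF polar_hom_right[OF q y] polar_hom_right[OF r y]]])
      (simp add: polar_prod[OF q r y])
  ultimately show ?thesis
    using q r by (simp add: quadratic_def socle_mult)
qed

lemma quadratic_one: "quadratic (\<lambda>_. \<one>)"
  by (simp add: quadratic_def polar_def socle_hom_def)

text \<open>The map is the product of the linear forms with kernels \<open>M\<close> and
  \<open>N\<close>, with coefficient \<open>t\<close>; its polar form is their wedge product. Each
  disjunction says that one of the two mixed products vanishes, and equal mixed products
  cancel.\<close>

lemma polar_pair:
  assumes N: "index_le_two M" "index_le_two N" and t: "t \<in> socle"
    and x: "x \<in> carrier G" and y: "y \<in> carrier G"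
  shows "polar (\<lambda>x. if x \<in> M \<or> x \<in> N then \<one> else t) x y =
    (if (x \<in> M \<or> y \<in> N) = (x \<in> N \<or> y \<in> M) then \<one> else t)"
  using t socle_square[OF t] socle_closed[OF t] x y
  by (cases "x \<in> M"; cases "y \<in> M"; cases "x \<in> N"; cases "y \<in> N")
    (simp_all add: polar_def index_le_two_mult[OF N(1)] index_le_two_mult[OF N(2)])

lemma quadratic_pair:
  assumes N: "index_le_two M" "index_le_two N" and t: "t \<in> socle"
  shows "quadratic (\<lambda>x. if x \<in> M \<or> x \<in> N then \<one> else t)" (is "quadratic ?q")
proof -
  have left: "socle_hom (\<lambda>x. polar ?q x y)" if y: "y \<in> carrier G" for y
    unfolding socle_hom_def
  proof (intro conjI ballI)
    show "polar ?q x y \<in> socle" if "x \<in> carrier G" for x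
      using t by (simp add: polar_pair[OF N t that y])
    fix x z assume xz: "x \<in> carrier G" "z \<in> carrier G"
    \<comment> \<open>Linearity is checked on all 64 membership patterns of three elements in two
      subgroups.\<close>
    show "polar ?q (x \<otimes> z) y = polar ?q x y \<otimes> polar ?q z y"
      using t socle_square[OF t] socle_closed[OF t]
      by (cases "x \<in> M"; cases "y \<in> M"; cases "x \<in> N"; cases "y \<in> N"; cases "z \<in> M"; cases "z \<in> N")
        (simp_all add: polar_pair[OF N t _ y] xz index_le_two_mult[OF N(1)] index_le_two_mult[OF N(2)])
  qed
  have "polar ?q x y = polar ?q y x" if "x \<in> carrier G" "y \<in> carrier G" for x y
    using that by (auto simp: polar_pair[OF N t])
  then have "socle_hom (polar ?q y)" if y: "y \<in> carrier G" for y
    using socle_hom_cong[OF left[OF y]] y by blast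
  with left show ?thesis
    using t N by (auto simp: quadratic_def index_two_core_def)
qed

text \<open>The condition \<open>w \<otimes> w = \<one>\<close> is what gives the derivation built
  from a quadratic map order at most two. By \<open>socle_hom_realised\<close> it is the only
  obstruction for a socle-valued homomorphism.\<close>

definition liftable :: "('a \<Rightarrow> 'a) \<Rightarrow> bool" where
  "liftable h \<longleftrightarrow> (\<exists>w\<in>socle_lift. w \<otimes> w = \<one> \<and> (\<forall>x\<in>carrier G. commutator w x = h x))"

lemma liftable_cong:
  "\<lbrakk>liftable g; \<And>x. x \<in> carrier G \<Longrightarrow> h x = g x\<rbrakk> \<Longrightarrow> liftable h"
  by (auto simp: liftable_def)

lemma liftable_one: "liftable (\<lambda>_. \<one>)"
  unfolding liftable_def
  by (rule bexI[of _ \<one>]) (auto simp: commutator_def subgroup.one_closed[OF socle_lift_subgroup])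

end

section \<open>Forms realised by elements of order at most two\<close>

context inner_frattini_involutions
begin

text \<open>[a, -] is a socle-valued homomorphism and \<open>b\<close> lies in the core, where all
  of these vanish.\<close>

lemma socle_lift_comm:
  assumes "a \<in> socle_lift" "b \<in> socle_lift" shows "a \<otimes> b = b \<otimes> a"
proof -
  have "commutator a b = \<one>"
    by (intro socle_hom_on_core socle_hom_commutator socle_lift_core assms)
  then show ?thesis using assms by (simp add: commutator_eq_one_iff socle_lift_closed)
qed

lemma socle_lift_interchange:
  assumes "a \<in> socle_lift" "b \<in> socle_lift" "c \<in> socle_lift" "d \<in> socle_lift"
  shows "a \<otimes> b \<otimes> (c \<otimes> d) = a \<otimes> c \<otimes> (b \<otimes> d)"
proof -
  have "a \<otimes> b \<otimes> (c \<otimes> d) = a \<otimes> (b \<otimes> c) \<otimes> d" using assms by (simp add: m_assoc socle_lift_closed)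
  also have "b \<otimes> c = c \<otimes> b" by (rule socle_lift_comm) (use assms in auto)
  finally show ?thesis using assms by (simp add: m_assoc socle_lift_closed)
qed

text \<open>Multiplying \<open>c\<close> by a suitable central element gives it the same square as
  \<open>b\<close>; since \<open>socle_lift\<close> is commutative, the quotient then squares to
  one. The obstruction to lifting thus lives in Z/Z^2.\<close>

lemma liftable_prod_if_square_class:
  assumes b: "b \<in> socle_lift" "\<And>x. x \<in> carrier G \<Longrightarrow> commutator b x = g x"
    and c: "c \<in> socle_lift" "\<And>x. x \<in> carrier G \<Longrightarrow> commutator c x = h x"
    and cl: "square_class (b \<otimes> b) = square_class (c \<otimes> c)"
  shows "liftable (\<lambda>x. g x \<otimes> h x)"
proof -
  obtain z where z: "z \<in> centre" "b \<otimes> b = z \<otimes> z \<otimes> (c \<otimes> c)"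
    using square_class_eqD[OF cl] socle_lift_closed[OF b(1)] by blast
  note zc = centre_closed[OF z(1)] and zl = centre_socle_lift[OF z(1)]
  note cc = socle_lift_closed[OF c(1)] and bc = socle_lift_closed[OF b(1)]
  define k where "k = z \<otimes> c"
  have k: "k \<in> socle_lift" by (simp add: k_def socle_lift_mult zl c)
  have kc: "k \<in> carrier G" using k by (rule socle_lift_closed)
  have bk: "b \<otimes> b = k \<otimes> k"
    using z(2) socle_lift_interchange[OF zl zl c(1) c(1)] by (simp add: k_def)
  have sq: "b \<otimes> inv k \<otimes> (b \<otimes> inv k) = \<one>"
    using socle_lift_interchange[OF b(1) socle_lift_inv[OF k] b(1) socle_lift_inv[OF k]] bk kc
    by (simp add: m_assoc)
  have com: "commutator (b \<otimes> inv k) x = g x \<otimes> h x" if x: "x \<in> carrier G" for x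
    using commutator_socle_lift_mult[OF bc socle_lift_inv[OF k] x]
      commutator_socle_lift_inv[OF k x] commutator_socle_lift_mult[OF zc c(1) x] x cc
    by (simp add: b c k_def commutator_centre[OF z(1)] commutator_closed[OF cc x, unfolded c(2)[OF x]])
  show ?thesis
    unfolding liftable_def using sq com b k by (intro bexI[of _ "b \<otimes> inv k"]) (auto simp: socle_lift_mult socle_lift_inv)
qed

lemma liftable_prod:
  assumes "liftable g" "liftable h" shows "liftable (\<lambda>x. g x \<otimes> h x)"
proof -
  obtain b c where "b \<in> socle_lift" "b \<otimes> b = \<one>" "\<And>x. x \<in> carrier G \<Longrightarrow> commutator b x = g x"
    "c \<in> socle_lift" "c \<otimes> c = \<one>" "\<And>x. x \<in> carrier G \<Longrightarrow> commutator c x = h x"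
    using assms unfolding liftable_def by blast
  then show ?thesis by (intro liftable_prod_if_square_class[of b g c h]) simp_all
qed

end

section \<open>Counting quadratic maps\<close>

context group
begin

lemma commutator_centre_mult:
  assumes z: "z \<in> centre" and g: "g \<in> carrier G" and y: "y \<in> carrier G"
  shows "commutator (z \<otimes> g) y = commutator g y"
proof -
  have "z \<otimes> commutator g y \<otimes> inv z = commutator g y"
    using assms centre_comm[OF z, of "commutator g y"] by (simp add: centre_closed m_assoc)
  then show ?thesis
    using assms by (simp add: commutator_mult_left centre_closed commutator_centre)
qed

text \<open>For fixed \<open>y\<close> the form is trivial, one of the two given forms or their
  product, according to the membership of \<open>y\<close> in \<open>M\<close> and
  \<open>N\<close>.\<close>

lemma liftable_polar_pair:
  assumes N: "index_le_two M" "index_le_two N" and t: "t \<in> socle" and y: "y \<in> carrier G"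
    and lM: "liftable (\<lambda>x. if x \<in> M then \<one> else t)" and lN: "liftable (\<lambda>x. if x \<in> N then \<one> else t)"
    and lMN: "liftable (\<lambda>x. (if x \<in> M then \<one> else t) \<otimes> (if x \<in> N then \<one> else t))"
  shows "liftable (\<lambda>x. polar (\<lambda>x. if x \<in> M \<or> x \<in> N then \<one> else t) x y)"
proof -
  let ?p = "\<lambda>x. if (x \<in> M \<or> y \<in> N) = (x \<in> N \<or> y \<in> M) then \<one> else t"
  have "liftable ?p"
  proof (cases "y \<in> M")
    case True
    then show ?thesis
      by (cases "y \<in> N") (auto intro: liftable_cong[OF lM] liftable_cong[OF liftable_one])
  next
    case False
    then show ?thesis
      using socle_square[OF t] socle_closed[OF t]
      by (cases "y \<in> N") (auto intro: liftable_cong[OF lN] liftable_cong[OF lMN])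
  qed
  then show ?thesis
    by (rule liftable_cong) (rule polar_pair[OF N t _ y])
qed

end

text \<open>\<open>S\<close> acts as a basis of V, and \<open>N s\<close> is the kernel of the
  coordinate at \<open>s\<close>. The last assumption makes the quotient by the second centre
  abelian; it is the form in which the class enters.\<close>

locale dual_generators = inner_frattini_involutions +
  fixes S :: "'a set" and N :: "'a \<Rightarrow> 'a set"
  assumes finite_S: "finite S" and S_closed: "S \<subseteq> carrier G" and generate_S: "generate G S = carrier G"
    and N_index: "s \<in> S \<Longrightarrow> index_le_two (N s)"
    and dual: "\<lbrakk>s \<in> S; t \<in> S\<rbrakk> \<Longrightarrow> t \<in> N s \<longleftrightarrow> t \<noteq> s"
    and class_le_3: "\<lbrakk>x \<in> carrier G; y \<in> carrier G\<rbrakk> \<Longrightarrow> commutator x y \<in> second_centre"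
begin

section \<open>Homomorphisms determined on the basis\<close>

lemma socle_hom_eqI:
  assumes g: "socle_hom g" and h: "socle_hom h" and eq: "\<And>s. s \<in> S \<Longrightarrow> g s = h s"
    and x: "x \<in> carrier G"
  shows "g x = h x"
proof -
  have "subgroup {x \<in> carrier G. g x = h x} G"
  proof (rule subgroupI)
    have "\<one> \<in> {x \<in> carrier G. g x = h x}" by (simp add: socle_hom_one[OF g] socle_hom_one[OF h])
    then show "{x \<in> carrier G. g x = h x} \<noteq> {}" by blast
  qed (auto simp: socle_hom_mult[OF g] socle_hom_mult[OF h] socle_hom_inv[OF g] socle_hom_inv[OF h])
  moreover have "S \<subseteq> {x \<in> carrier G. g x = h x}" using eq S_closed by auto
  ultimately have "generate G S \<subseteq> {x \<in> carrier G. g x = h x}" by (intro generate_subgroup_incl)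
  then show ?thesis using x generate_S by auto
qed

text \<open>The map sends \<open>x\<close> to the product of the \<open>v s\<close> over those
  \<open>s\<close> in \<open>F\<close> with \<open>x\<close> outside \<open>N s\<close>. It is a
  homomorphism because the factors commute and square to one; the induction adds one coordinate at a
  time.\<close>

lemma socle_lift_hom_extension:
  assumes "finite F" "F \<subseteq> S" and v: "\<And>s. s \<in> S \<Longrightarrow> v s \<in> socle_lift" "\<And>s. s \<in> S \<Longrightarrow> v s \<otimes> v s = \<one>"
  shows "\<exists>w. (\<forall>x\<in>carrier G. w x \<in> socle_lift \<and> w x \<otimes> w x = \<one>) \<and>
    (\<forall>x\<in>carrier G. \<forall>y\<in>carrier G. w (x \<otimes> y) = w x \<otimes> w y) \<and> (\<forall>x\<in>index_two_core. w x = \<one>) \<and>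
    (\<forall>s\<in>S. w s = (if s \<in> F then v s else \<one>))"
  using assms(1,2)
proof (induction F)
  case empty
  show ?case
    by (rule exI[of _ "\<lambda>_. \<one>"]) (simp add: subgroup.one_closed[OF socle_lift_subgroup])
next
  case (insert a F)
  then obtain w where W: "\<forall>x\<in>carrier G. w x \<in> socle_lift \<and> w x \<otimes> w x = \<one>"
    "\<forall>x\<in>carrier G. \<forall>y\<in>carrier G. w (x \<otimes> y) = w x \<otimes> w y"
    "\<forall>x\<in>index_two_core. w x = \<one>" "\<forall>s\<in>S. w s = (if s \<in> F then v s else \<one>)"
    by auto
  note w = W(1)[rule_format, THEN conjunct1] W(1)[rule_format, THEN conjunct2] W(2-)[rule_format]
  have a: "a \<in> S" using insert by simp
  let ?k = "\<lambda>x. if x \<in> N a then \<one> else v a"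
  have k: "?k x \<in> socle_lift" "?k x \<otimes> ?k x = \<one>" for x
    using v[OF a] by (simp_all add: subgroup.one_closed[OF socle_lift_subgroup])
  have kmult: "?k (x \<otimes> y) = ?k x \<otimes> ?k y" if "x \<in> carrier G" "y \<in> carrier G" for x y
    using that v[OF a] by (auto simp: index_le_two_mult[OF N_index[OF a]] socle_lift_closed)
  show ?case
  proof (rule exI[of _ "\<lambda>x. w x \<otimes> ?k x"], intro conjI ballI)
    fix x y assume x: "x \<in> carrier G" and y: "y \<in> carrier G"
    show "w (x \<otimes> y) \<otimes> ?k (x \<otimes> y) = w x \<otimes> ?k x \<otimes> (w y \<otimes> ?k y)"
      unfolding kmult[OF x y] w(3)[OF x y]
      by (intro socle_lift_interchange w(1) x y k)
  next
    fix x assume x: "x \<in> carrier G"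
    show "w x \<otimes> ?k x \<in> socle_lift" by (intro socle_lift_mult w(1) x k)
    have "w x \<otimes> ?k x \<otimes> (w x \<otimes> ?k x) = w x \<otimes> w x \<otimes> (?k x \<otimes> ?k x)"
      by (intro socle_lift_interchange w(1) x k)
    then show "w x \<otimes> ?k x \<otimes> (w x \<otimes> ?k x) = \<one>" using w(2)[OF x] k by simp
  next
    fix x assume "x \<in> index_two_core"
    then show "w x \<otimes> ?k x = \<one>"
      using w(4)[of x] N_index[OF a] by (simp add: index_two_core_def)
  next
    fix s assume s: "s \<in> S"
    show "w s \<otimes> ?k s = (if s \<in> insert a F then v s else \<one>)"
      using w(5)[OF s] dual[OF a s] insert(2) v(1)[OF s] by (auto simp: socle_lift_closed)
  qed
qed

text \<open>Extend the elements realising the partial polar forms to a homomorphism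
  \<open>w\<close>. Then d(x) = w(x) q(x) is a derivation: conjugating \<open>d y\<close> by
  \<open>x\<close> produces the factor \<open>polar q x y\<close>, which also separates q(x y) from
  q(x) q(y). The element inducing the automorphism recovers the polar form as a double
  commutator.\<close>

lemma quadratic_inner_derivation:
  assumes q: "quadratic q" and lift: "\<And>s. s \<in> S \<Longrightarrow> liftable (\<lambda>x. polar q x s)"
  shows "\<exists>c\<in>carrier G. c \<otimes> c \<in> second_centre \<and> (\<forall>x\<in>carrier G. commutator c x \<in> socle_lift \<and>
    (\<forall>y\<in>carrier G. commutator (commutator c x) y = polar q y x))"
proof -
  have "\<forall>s\<in>S. \<exists>w. w \<in> socle_lift \<and> w \<otimes> w = \<one> \<and> (\<forall>x\<in>carrier G. commutator w x = polar q x s)"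
    using lift unfolding liftable_def by blast
  then obtain v where v: "\<And>s. s \<in> S \<Longrightarrow> v s \<in> socle_lift" "\<And>s. s \<in> S \<Longrightarrow> v s \<otimes> v s = \<one>"
    "\<And>s x. \<lbrakk>s \<in> S; x \<in> carrier G\<rbrakk> \<Longrightarrow> commutator (v s) x = polar q x s"
    by metis
  obtain w where W: "\<forall>x\<in>carrier G. w x \<in> socle_lift \<and> w x \<otimes> w x = \<one>"
    "\<forall>x\<in>carrier G. \<forall>y\<in>carrier G. w (x \<otimes> y) = w x \<otimes> w y"
    "\<forall>x\<in>index_two_core. w x = \<one>" "\<forall>s\<in>S. w s = v s"
    using socle_lift_hom_extension[OF finite_S order_refl, of v] v(1,2) by auto
  note w = W(1)[rule_format, THEN conjunct1] W(1)[rule_format, THEN conjunct2] W(2-)[rule_format]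
  \<comment> \<open>Both sides are linear in \<open>y\<close> and agree on \<open>S\<close>.\<close>
  have wcom: "commutator (w y) x = polar q x y" if x: "x \<in> carrier G" and y: "y \<in> carrier G" for x y
  proof (rule socle_hom_eqI[OF _ polar_hom_right[OF q x] _ y])
    show "socle_hom (\<lambda>y. commutator (w y) x)"
      using w(1,3) x by (simp add: socle_hom_def commutator_socle commutator_socle_lift_mult socle_lift_closed)
    show "commutator (w s) x = polar q x s" if "s \<in> S" for s
      using that v(3) w(5) x by simp
  qed
  define d where "d x = w x \<otimes> q x" for x
  have ql: "q x \<in> socle_lift" and qs: "q x \<in> socle" and qq: "q x \<otimes> q x = \<one>" if "x \<in> carrier G" for x
    using quadratic_socle[OF q that] by (simp_all add: centre_socle_lift socle_centre socle_square)
  have d: "d x \<in> socle_lift" if "x \<in> carrier G" for x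
    using that by (simp add: d_def socle_lift_mult w(1) ql)
  have dd: "d x \<otimes> d x = \<one>" if "x \<in> carrier G" for x
    using socle_lift_interchange[of "w x" "q x" "w x" "q x"] that by (simp add: d_def w ql qq)
  have dcom: "commutator (d x) y = polar q y x" if "x \<in> carrier G" "y \<in> carrier G" for x y
    using that wcom[OF that(2,1)] socle_hom_closed[OF polar_hom_right[OF q that(2)] that(1)]
    by (simp add: d_def commutator_socle_lift_mult ql socle_lift_closed w(1)
        commutator_centre[OF socle_centre[OF qs]])
  obtain c where c: "c \<in> carrier G" "\<And>x. x \<in> carrier G \<Longrightarrow> commutator c x = d x"
  proof (rule inner_derivation[of d])
    show "d x \<in> carrier G" if "x \<in> carrier G" for x using d[OF that] by (rule socle_lift_closed)
    show "d x = \<one>" if "x \<in> index_two_core" for x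
      using that by (simp add: d_def w(4) quadratic_core[OF q])
    show "d (x \<otimes> y) = d x \<otimes> (x \<otimes> d y \<otimes> inv x)" if x: "x \<in> carrier G" and y: "y \<in> carrier G" for x y
    proof -
      let ?p = "polar q x y"
      have p: "?p \<in> socle" by (rule socle_hom_socle[OF polar_hom_right[OF q x] y])
      note cl = socle_lift_closed[OF w(1)[OF x]] socle_lift_closed[OF w(1)[OF y]] socle_closed[OF p]
        socle_closed[OF qs[OF x]] socle_closed[OF qs[OF y]]
      have "x \<otimes> d y \<otimes> inv x = commutator x (d y) \<otimes> d y"
        using x socle_lift_closed[OF d[OF y]] by (simp add: commutator_def m_assoc)
      also have "commutator x (d y) = ?p"
        using commutator_socle_lift_swap[OF d[OF y] x] dcom[OF y x] by simp
      finally have conj: "x \<otimes> d y \<otimes> inv x = ?p \<otimes> (w y \<otimes> q y)" by (simp add: d_def)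
      have "d (x \<otimes> y) = w x \<otimes> (w y \<otimes> (q x \<otimes> (q y \<otimes> ?p)))"
        using x y cl by (simp add: d_def w(3) quadratic_mult[OF q x y] m_assoc)
      also have "q y \<otimes> ?p = ?p \<otimes> q y" by (rule socle_comm[OF qs[OF y] cl(3)])
      also have "w y \<otimes> (q x \<otimes> (?p \<otimes> q y)) = q x \<otimes> (w y \<otimes> (?p \<otimes> q y))"
        by (rule socle_left_comm[OF qs[OF x]]) (use cl in auto)
      also have "w y \<otimes> (?p \<otimes> q y) = ?p \<otimes> (w y \<otimes> q y)"
        by (rule socle_left_comm[OF p]) (use cl in auto)
      finally show ?thesis unfolding conj using cl by (simp add: d_def m_assoc)
    qed
    show "d (d x \<otimes> x) \<otimes> d x = \<one>" if x: "x \<in> carrier G" for x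
    proof -
      \<comment> \<open>On the core \<open>w\<close>, \<open>q\<close> and the polar form are
        trivial, so d(d(x) x) = d(x), which squares to one.\<close>
      have e: "d x \<in> index_two_core" by (rule socle_lift_core[OF d[OF x]])
      have ec: "d x \<in> carrier G" using e by (rule index_two_core_closed)
      have "polar q (d x) x = \<one>" by (rule socle_hom_on_core[OF polar_hom_left[OF q x] e])
      then have "d (d x \<otimes> x) = d x"
        using x ec by (simp add: d_def[of "d x \<otimes> x"] w(3) w(4)[OF e] quadratic_mult[OF q] quadratic_core[OF q e]
            socle_lift_closed[OF w(1)] socle_closed[OF qs]) (simp add: d_def)
      then show ?thesis using dd[OF x] by simp
    qed
  qed blast
  \<comment> \<open>As d(x)^2 = 1, the commutator [c^2, x] reduces to [c, d(x)], which lies in the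
    socle.\<close>
  have "commutator (c \<otimes> c) x \<in> centre" if x: "x \<in> carrier G" for x
  proof -
    have "commutator (c \<otimes> c) x = c \<otimes> d x \<otimes> inv c \<otimes> d x"
      using c x by (simp add: commutator_mult_left)
    also have "c \<otimes> d x \<otimes> inv c = commutator c (d x) \<otimes> d x"
      using c(1) socle_lift_closed[OF d[OF x]] by (simp add: commutator_def m_assoc)
    also have "\<dots> \<otimes> d x = commutator c (d x)"
      using c(1) socle_lift_closed[OF d[OF x]] dd[OF x] by (simp add: m_assoc)
    also have "\<dots> \<in> centre"
      using commutator_socle_lift_swap[OF d[OF x] c(1)] commutator_socle[OF d[OF x] c(1)]
      by (simp add: socle_centre)
    finally show ?thesis .
  qed
  then have "c \<otimes> c \<in> second_centre" using c(1) by (simp add: second_centre_def)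
  then show ?thesis using c d dcom by (intro bexI[of _ c]) auto
qed

text \<open>Each map yields an element whose square lies in the second centre and whose double
  commutators give the polar form. Elements congruent modulo the second centre have equal double
  commutators, so distinct indices stay distinct in that abelian quotient.\<close>

lemma card_quadratic_family_le:
  assumes q: "\<And>i. i \<in> I \<Longrightarrow> quadratic (q i)"
    and lift: "\<And>i s. \<lbrakk>i \<in> I; s \<in> S\<rbrakk> \<Longrightarrow> liftable (\<lambda>x. polar (q i) x s)"
    and inj: "\<And>i j. \<lbrakk>i \<in> I; j \<in> I; \<And>s t. \<lbrakk>s \<in> S; t \<in> S\<rbrakk> \<Longrightarrow> polar (q i) s t = polar (q j) s t\<rbrakk> \<Longrightarrow> i = j"
  shows "card I \<le> 2 ^ card S"
proof -
  have "\<forall>i\<in>I. \<exists>c. c \<in> carrier G \<and> c \<otimes> c \<in> second_centre \<and> (\<forall>x\<in>carrier G. commutator c x \<in> socle_lift \<and>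
      (\<forall>y\<in>carrier G. commutator (commutator c x) y = polar (q i) y x))"
    using quadratic_inner_derivation[OF q lift] by blast
  then obtain c where c: "\<And>i. i \<in> I \<Longrightarrow> c i \<in> carrier G" "\<And>i. i \<in> I \<Longrightarrow> c i \<otimes> c i \<in> second_centre"
    "\<And>i x. \<lbrakk>i \<in> I; x \<in> carrier G\<rbrakk> \<Longrightarrow> commutator (c i) x \<in> socle_lift"
    "\<And>i x y. \<lbrakk>i \<in> I; x \<in> carrier G; y \<in> carrier G\<rbrakk> \<Longrightarrow> commutator (commutator (c i) x) y = polar (q i) y x"
    by metis
  show ?thesis
  proof (rule card_square_roots_le[OF fin finite_S S_closed generate_S second_centre_normal class_le_3 c(1,2)])
    fix i j k assume i: "i \<in> I" and j: "j \<in> I" and k: "k \<in> second_centre" and eq: "c i = k \<otimes> c j"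
    show "i = j"
    proof (rule inj[OF i j])
      fix s t assume "s \<in> S" "t \<in> S"
      then have s: "s \<in> carrier G" and t: "t \<in> carrier G" using S_closed by auto
      let ?e = "commutator (c j) t"
      have kc: "k \<in> carrier G" using k by (simp add: second_centre_def)
      have e: "?e \<in> carrier G" using c(1)[OF j] t by simp
      have z1: "commutator k ?e \<in> centre" and z2: "commutator k t \<in> centre"
        using k e t by (simp_all add: second_centre_def)
      \<comment> \<open>A factor from the second centre changes [c_j, t] only by central elements,
        which disappear in the next commutator.\<close>
      have "commutator (c i) t = k \<otimes> ?e \<otimes> inv k \<otimes> commutator k t"
        unfolding eq by (rule commutator_mult_left[OF kc c(1)[OF j] t])
      also have "k \<otimes> ?e \<otimes> inv k = commutator k ?e \<otimes> ?e"
        using kc e by (simp add: commutator_def[of k ?e] m_assoc)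
      also have "\<dots> \<otimes> commutator k t = commutator k t \<otimes> (commutator k ?e \<otimes> ?e)"
        using centre_comm[OF z2, of "commutator k ?e \<otimes> ?e"] e centre_closed[OF z1] by simp
      finally have "commutator (commutator (c i) t) s = commutator ?e s"
        using e s centre_closed[OF z1] by (simp only: commutator_centre_mult[OF z2] commutator_centre_mult[OF z1] m_closed)
      then show "polar (q i) s t = polar (q j) s t"
        using c(4)[OF i t s] c(4)[OF j t s] by simp
    qed
  qed
qed

text \<open>Multiply the maps of \<open>quadratic_pair\<close> over the pairs in \<open>P\<close>,
  with coefficients \<open>m\<close>. \<open>T\<close> and \<open>K\<close> are arbitrary because
  the case |R| = 2 uses modified coordinates on a smaller set; liftability is an implication because
  it is available only there.\<close>

lemma quadratic_with_polar:
  assumes K: "\<And>s. s \<in> T \<Longrightarrow> index_le_two (K s)" "\<And>s t. \<lbrakk>s \<in> T; t \<in> T\<rbrakk> \<Longrightarrow> t \<in> K s \<longleftrightarrow> t \<noteq> s"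
    and T: "T \<subseteq> S" and "finite P" "P \<subseteq> {p. p \<subseteq> T \<and> card p = 2}" "\<forall>p\<in>P. m p \<in> socle"
  shows "\<exists>q. quadratic q \<and>
    (\<forall>s\<in>T. \<forall>t\<in>T. s \<noteq> t \<longrightarrow> polar q s t = (if {s, t} \<in> P then m {s, t} else \<one>)) \<and>
    ((\<forall>s\<in>T. \<forall>r\<in>socle. liftable (\<lambda>x. if x \<in> K s then \<one> else r)) \<longrightarrow>
      (\<forall>y\<in>carrier G. liftable (\<lambda>x. polar q x y)))"
  using assms(4-)
proof (induction P)
  case empty
  have "polar (\<lambda>_. \<one>) x y = \<one>" for x y by (simp add: polar_def)
  then show ?case by (intro exI[of _ "\<lambda>_. \<one>"]) (simp add: quadratic_one liftable_one)
next
  case (insert p P)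
  have "P \<subseteq> {p. p \<subseteq> T \<and> card p = 2}" "\<forall>p\<in>P. m p \<in> socle"
    using insert.prems by auto
  from insert.IH[OF this] obtain q where Q: "quadratic q"
    "\<forall>s\<in>T. \<forall>t\<in>T. s \<noteq> t \<longrightarrow> polar q s t = (if {s, t} \<in> P then m {s, t} else \<one>)"
    "(\<forall>s\<in>T. \<forall>r\<in>socle. liftable (\<lambda>x. if x \<in> K s then \<one> else r)) \<longrightarrow>
      (\<forall>y\<in>carrier G. liftable (\<lambda>x. polar q x y))"
    by (elim exE conjE) (rule that)
  note q = Q(1) Q(2)[rule_format] Q(3)[THEN mp, THEN bspec]
  obtain a b where ab: "p = {a, b}" "a \<noteq> b" "a \<in> T" "b \<in> T"
    using insert.prems(1) by (auto simp: card_2_iff)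
  have mp: "m p \<in> socle" using insert.prems by simp
  let ?e = "\<lambda>x. if x \<in> K a \<or> x \<in> K b then \<one> else m p"
  have e: "quadratic ?e" by (rule quadratic_pair[OF K(1)[OF ab(3)] K(1)[OF ab(4)] mp])
  have Tc: "x \<in> carrier G" if "x \<in> T" for x using that T S_closed by blast
  show ?case
  proof (rule exI[of _ "\<lambda>x. q x \<otimes> ?e x"], intro conjI impI ballI)
    show "quadratic (\<lambda>x. q x \<otimes> ?e x)" by (rule quadratic_prod[OF q(1) e])
  next
    fix s t assume st: "s \<in> T" "t \<in> T" "s \<noteq> t"
    have "polar ?e s t = (if {s, t} = p then m p else \<one>)"
      unfolding polar_pair[OF K(1)[OF ab(3)] K(1)[OF ab(4)] mp Tc[OF st(1)] Tc[OF st(2)]]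
      using K(2) ab st by (auto simp: doubleton_eq_iff)
    then show "polar (\<lambda>x. q x \<otimes> ?e x) s t = (if {s, t} \<in> insert p P then m {s, t} else \<one>)"
      unfolding polar_prod[OF q(1) e Tc[OF st(1)] Tc[OF st(2)]] q(2)[OF st]
      using insert(2) insert.prems(2) mp by (auto simp: socle_closed)
  next
    fix y assume l: "\<forall>s\<in>T. \<forall>r\<in>socle. liftable (\<lambda>x. if x \<in> K s then \<one> else r)" and y: "y \<in> carrier G"
    have "liftable (\<lambda>x. polar ?e x y)"
      using l ab mp by (intro liftable_polar_pair K y liftable_prod) auto
    then have "liftable (\<lambda>x. polar q x y \<otimes> polar ?e x y)"
      by (intro liftable_prod q(3) l y)
    then show "liftable (\<lambda>x. polar (\<lambda>x. q x \<otimes> ?e x) x y)"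
      by (rule liftable_cong) (rule polar_prod[OF q(1) e _ y])
  qed
qed

text \<open>With all pairs as \<open>P\<close>, every prescription of off-diagonal values is
  realised. The prescriptions are extensional, so that these values determine them and they can be
  counted.\<close>

lemma polar_family:
  assumes K: "\<And>s. s \<in> T \<Longrightarrow> index_le_two (K s)" "\<And>s t. \<lbrakk>s \<in> T; t \<in> T\<rbrakk> \<Longrightarrow> t \<in> K s \<longleftrightarrow> t \<noteq> s"
    and T: "T \<subseteq> S"
  obtains q where "\<And>m. m \<in> {p. p \<subseteq> T \<and> card p = 2} \<rightarrow>\<^sub>E socle \<Longrightarrow> quadratic (q m)"
    "\<And>m s t. \<lbrakk>m \<in> {p. p \<subseteq> T \<and> card p = 2} \<rightarrow>\<^sub>E socle; s \<in> T; t \<in> T; s \<noteq> t\<rbrakk> \<Longrightarrow> polar (q m) s t = m {s, t}"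
    "\<And>m y. \<lbrakk>m \<in> {p. p \<subseteq> T \<and> card p = 2} \<rightarrow>\<^sub>E socle; y \<in> carrier G;
      \<And>s r. \<lbrakk>s \<in> T; r \<in> socle\<rbrakk> \<Longrightarrow> liftable (\<lambda>x. if x \<in> K s then \<one> else r)\<rbrakk> \<Longrightarrow>
      liftable (\<lambda>x. polar (q m) x y)"
proof -
  let ?P = "{p. p \<subseteq> T \<and> card p = 2}"
  let ?M = "?P \<rightarrow>\<^sub>E socle"
  have finP: "finite ?P" using finite_subset[OF T finite_S] by simp
  have "\<forall>m\<in>?P \<rightarrow>\<^sub>E socle. \<exists>q. quadratic q \<and>
    (\<forall>s\<in>T. \<forall>t\<in>T. s \<noteq> t \<longrightarrow> polar q s t = (if {s, t} \<in> ?P then m {s, t} else \<one>)) \<and>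
    ((\<forall>s\<in>T. \<forall>r\<in>socle. liftable (\<lambda>x. if x \<in> K s then \<one> else r)) \<longrightarrow>
      (\<forall>y\<in>carrier G. liftable (\<lambda>x. polar q x y)))"
  proof
    fix m assume m: "m \<in> ?P \<rightarrow>\<^sub>E socle"
    show "\<exists>q. quadratic q \<and>
    (\<forall>s\<in>T. \<forall>t\<in>T. s \<noteq> t \<longrightarrow> polar q s t = (if {s, t} \<in> ?P then m {s, t} else \<one>)) \<and>
    ((\<forall>s\<in>T. \<forall>r\<in>socle. liftable (\<lambda>x. if x \<in> K s then \<one> else r)) \<longrightarrow>
      (\<forall>y\<in>carrier G. liftable (\<lambda>x. polar q x y)))"
      by (rule quadratic_with_polar[OF K T finP order_refl]) (use m in auto)
  qed
  from bchoice[OF this] obtain q where q: "\<forall>m\<in>?P \<rightarrow>\<^sub>E socle. quadratic (q m) \<and>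
    (\<forall>s\<in>T. \<forall>t\<in>T. s \<noteq> t \<longrightarrow> polar (q m) s t = (if {s, t} \<in> ?P then m {s, t} else \<one>)) \<and>
    ((\<forall>s\<in>T. \<forall>r\<in>socle. liftable (\<lambda>x. if x \<in> K s then \<one> else r)) \<longrightarrow>
      (\<forall>y\<in>carrier G. liftable (\<lambda>x. polar (q m) x y)))" by blast
  show thesis
  proof (rule that[of q])
    fix m s t assume "m \<in> ?P \<rightarrow>\<^sub>E socle" "s \<in> T" "t \<in> T" "s \<noteq> t"
    moreover from this have "{s, t} \<in> ?P" by (auto simp: card_2_iff)
    ultimately show "polar (q m) s t = m {s, t}" using bspec[OF q] by (simp del: mem_Collect_eq)
  next
    fix m assume "m \<in> ?M"
    from bspec[OF q this] show "quadratic (q m)" by (rule conjunct1)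
  next
    fix m y assume m: "m \<in> ?M" and y: "y \<in> carrier G"
      and l: "\<And>s r. \<lbrakk>s \<in> T; r \<in> socle\<rbrakk> \<Longrightarrow> liftable (\<lambda>x. if x \<in> K s then \<one> else r)"
    from bspec[OF q m] have "(\<forall>s\<in>T. \<forall>r\<in>socle. liftable (\<lambda>x. if x \<in> K s then \<one> else r)) \<longrightarrow>
      (\<forall>y\<in>carrier G. liftable (\<lambda>x. polar (q m) x y))" by (elim conjE)
    then show "liftable (\<lambda>x. polar (q m) x y)" using l y by blast
  qed
qed

section \<open>Counting the prescribed forms\<close>

lemma polar_family_inj:
  assumes m: "m \<in> {p. p \<subseteq> T \<and> card p = 2} \<rightarrow>\<^sub>E socle" "m' \<in> {p. p \<subseteq> T \<and> card p = 2} \<rightarrow>\<^sub>E socle"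
    and eq: "\<And>s t. \<lbrakk>s \<in> T; t \<in> T; s \<noteq> t\<rbrakk> \<Longrightarrow> m {s, t} = m' {s, t}"
  shows "m = m'"
proof (rule PiE_ext[OF m])
  fix p assume "p \<in> {p. p \<subseteq> T \<and> card p = 2}"
  then obtain s t where "p = {s, t}" "s \<noteq> t" "s \<in> T" "t \<in> T" by (auto simp: card_2_iff)
  then show "m p = m' p" using eq by simp
qed

lemma card_pairs:
  assumes "T \<subseteq> S"
  shows "card ({p. p \<subseteq> T \<and> card p = 2} \<rightarrow>\<^sub>E socle) = card socle ^ (card T choose 2)"
    and "finite ({p. p \<subseteq> T \<and> card p = 2} \<rightarrow>\<^sub>E socle)"
proof -
  have T: "finite T" using finite_subset[OF assms finite_S] .
  have socle: "finite socle" using finite_subset[OF _ fin] socle_closed by blast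
  show "card ({p. p \<subseteq> T \<and> card p = 2} \<rightarrow>\<^sub>E socle) = card socle ^ (card T choose 2)"
    using T by (simp add: card_funcsetE n_subsets)
  show "finite ({p. p \<subseteq> T \<and> card p = 2} \<rightarrow>\<^sub>E socle)"
    using T socle by (intro finite_PiE) auto
qed

text \<open>Write d = |S|. For every form record the square classes attached to its d partial polar
  forms; there are |R|^d records. Maps with the same record differ by maps with liftable partial
  polar forms, so at most 2^d forms share a record. As d(d-1)/2 \<ge> 2d for d \<ge> 5, this gives
  |R|^d \<le> 2^d, impossible for |R| \<ge> 3.\<close>

lemma large_socle_contradiction:
  assumes d: "card S \<ge> 5" and soc: "card socle \<ge> 3"
  shows False
proof -
  let ?M = "{p. p \<subseteq> S \<and> card p = 2} \<rightarrow>\<^sub>E socle"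
  obtain q where q: "\<And>m. m \<in> ?M \<Longrightarrow> quadratic (q m)"
    "\<And>m s t. \<lbrakk>m \<in> ?M; s \<in> S; t \<in> S; s \<noteq> t\<rbrakk> \<Longrightarrow> polar (q m) s t = m {s, t}"
  proof (rule polar_family[OF N_index dual order_refl], assumption+, goal_cases)
    case (1 q)
    show thesis by (rule that) (fact 1)+
  qed
  define b where "b m s = (SOME b. b \<in> socle_lift \<and> (\<forall>x\<in>carrier G. commutator b x = polar (q m) x s))" for m s
  have b_some: "b m s \<in> socle_lift \<and> (\<forall>x\<in>carrier G. commutator (b m s) x = polar (q m) x s)"
    if "m \<in> ?M" "s \<in> S" for m s
  proof -
    have "s \<in> carrier G" using that S_closed by blast
    then have "socle_hom (\<lambda>x. polar (q m) x s)" by (rule polar_hom_left[OF q(1)[OF that(1)]])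
    then have "\<exists>b. b \<in> socle_lift \<and> (\<forall>x\<in>carrier G. commutator b x = polar (q m) x s)"
      by (rule socle_hom_realised) blast
    then show ?thesis unfolding b_def by (rule someI_ex)
  qed
  note b = b_some[THEN conjunct1] b_some[THEN conjunct2, THEN bspec]
  define \<theta> where "\<theta> m = (\<lambda>s\<in>S. square_class (b m s \<otimes> b m s))" for m
  let ?B = "S \<rightarrow>\<^sub>E square_class ` centre"
  have \<theta>: "\<theta> \<in> ?M \<rightarrow> ?B"
  proof
    fix m assume m: "m \<in> ?M"
    have "b m s \<otimes> b m s \<in> centre" if "s \<in> S" for s
      by (rule socle_lift_square_centre[OF b(1)[OF m that]])
    then show "\<theta> m \<in> ?B" unfolding \<theta>_def by (auto simp del: mem_Collect_eq)
  qed
  have "finite centre" using finite_subset[OF subgroup.subset[OF centre_subgroup] fin] .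
  then have finB: "finite ?B" using finite_S by (intro finite_PiE) auto
  have neB: "?B \<noteq> {}"
    using subgroup.one_closed[OF centre_subgroup] by (auto simp: PiE_eq_empty_iff)
  \<comment> \<open>Some record \<open>y\<close> is shared by at least the average number of
    forms.\<close>
  from pigeonhole_card[OF \<theta> card_pairs(2)[OF order_refl] finB neB]
  obtain y where y: "card (\<theta> -` {y} \<inter> ?M) * card ?B \<ge> card ?M" by (elim bexE)
  define I where "I = \<theta> -` {y} \<inter> ?M"
  have "card I \<le> 2 ^ card S"
  proof (cases "I = {}")
    case False
    then obtain m0 where m0: "m0 \<in> ?M" "\<theta> m0 = y" by (auto simp: I_def)
    have I: "m \<in> ?M" "\<theta> m = \<theta> m0" if "m \<in> I" for m using that m0 by (auto simp: I_def)
    \<comment> \<open>Multiplying by the fixed map \<open>q m0\<close> makes all partial polar forms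
      liftable and keeps the forms distinct.\<close>
    show ?thesis
    proof (rule card_quadratic_family_le)
      show "quadratic (\<lambda>x. q m x \<otimes> q m0 x)" if "m \<in> I" for m
        by (rule quadratic_prod[OF q(1)[OF I(1)[OF that]] q(1)[OF m0(1)]])
      show "liftable (\<lambda>x. polar (\<lambda>x. q m x \<otimes> q m0 x) x s)" if m: "m \<in> I" and s: "s \<in> S" for m s
      proof -
        have "square_class (b m s \<otimes> b m s) = square_class (b m0 s \<otimes> b m0 s)"
          using fun_cong[OF I(2)[OF m], of s] s by (simp add: \<theta>_def)
        then have "liftable (\<lambda>x. polar (q m) x s \<otimes> polar (q m0) x s)"
          using b(1)[OF I(1)[OF m] s] b(2)[OF I(1)[OF m] s] b(1)[OF m0(1) s] b(2)[OF m0(1) s]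
          by (intro liftable_prod_if_square_class[of "b m s" _ "b m0 s"]) simp_all
        then show ?thesis
          by (rule liftable_cong)
            (rule polar_prod[OF q(1)[OF I(1)[OF m]] q(1)[OF m0(1)] _ subsetD[OF S_closed s]])
      qed
      fix m m' assume mm: "m \<in> I" "m' \<in> I"
        and eq: "\<And>s t. \<lbrakk>s \<in> S; t \<in> S\<rbrakk> \<Longrightarrow> polar (\<lambda>x. q m x \<otimes> q m0 x) s t = polar (\<lambda>x. q m' x \<otimes> q m0 x) s t"
      show "m = m'"
      proof (rule polar_family_inj[OF I(1)[OF mm(1)] I(1)[OF mm(2)]])
        fix s t assume st: "s \<in> S" "t \<in> S" "s \<noteq> t"
        then have c: "s \<in> carrier G" "t \<in> carrier G" using S_closed by auto
        have cl: "polar (q k) s t \<in> carrier G" if "k \<in> ?M" for k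
          using socle_hom_closed[OF polar_hom_right[OF q(1)[OF that] c(1)] c(2)] .
        have "polar (q m) s t \<otimes> polar (q m0) s t = polar (q m') s t \<otimes> polar (q m0) s t"
          using eq[OF st(1,2)] polar_prod[OF q(1)[OF I(1)[OF mm(1)]] q(1)[OF m0(1)] c]
            polar_prod[OF q(1)[OF I(1)[OF mm(2)]] q(1)[OF m0(1)] c] by simp
        then have "polar (q m) s t = polar (q m') s t"
          using cl[OF I(1)[OF mm(1)]] cl[OF I(1)[OF mm(2)]] cl[OF m0(1)] by simp
        then show "m {s, t} = m' {s, t}"
          using q(2)[OF I(1)[OF mm(1)] st] q(2)[OF I(1)[OF mm(2)] st] by simp
      qed
    qed
  qed simp
  then have "card I * card socle ^ card S \<le> 2 ^ card S * card socle ^ card S"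
    by (rule mult_le_mono1)
  moreover have "card socle ^ (card S choose 2) \<le> card I * card socle ^ card S"
    using y unfolding I_def card_funcsetE[OF finite_S] card_pairs(1)[OF order_refl] card_square_class[OF fin] .
  ultimately have "card socle ^ (card S choose 2) \<le> 2 ^ card S * card socle ^ card S"
    by (rule order_trans[rotated])
  moreover have "card S + card S \<le> card S choose 2"
  proof -
    have "4 * card S \<le> card S * (card S - 1)" using d by (simp add: mult.commute)
    then have "4 * card S div 2 \<le> card S * (card S - 1) div 2" by (rule div_le_mono)
    then show ?thesis by (simp add: choose_two)
  qed
  then have "card socle ^ (card S + card S) \<le> card socle ^ (card S choose 2)"
    using soc by (intro power_increasing) auto
  ultimately have "card socle ^ (card S + card S) \<le> 2 ^ card S * card socle ^ card S"
    by (rule order_trans[rotated])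
  then have "card socle ^ card S * card socle ^ card S \<le> 2 ^ card S * card socle ^ card S"
    by (simp only: power_add)
  then have "card socle ^ card S \<le> 2 ^ card S" using soc by simp
  moreover have "2 ^ card S < card socle ^ card S"
    using soc d by (intro power_strict_mono) auto
  ultimately show False by simp
qed

text \<open>Here Z has only two square classes, so two non-liftable coordinates share the nontrivial
  one and their product is liftable. Adding one bad coordinate to the other bad ones leaves d - 1
  liftable coordinates, where d = |S|. They carry 2 to the power (d-1)(d-2)/2 forms, and this
  exponent exceeds d for d \<ge> 5.\<close>

lemma small_socle_contradiction:
  assumes d: "card S \<ge> 5" and soc: "card socle = 2"
  shows False
proof -
  have "card (socle - {\<one>}) = 1" using soc by simp
  then obtain t where t': "socle - {\<one>} = {t}" by (rule card_1_singletonE)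
  have "socle = insert \<one> (socle - {\<one>})" using socle_one by blast
  moreover have "t \<in> socle - {\<one>}" unfolding t' by simp
  ultimately have t: "socle = {\<one>, t}" "t \<noteq> \<one>" "t \<in> socle" using t' by simp_all
  let ?\<chi> = "\<lambda>s x. if x \<in> N s then \<one> else t"
  have two_bad: "liftable (\<lambda>x. ?\<chi> s x \<otimes> ?\<chi> r x)"
    if s: "s \<in> S" "\<not> liftable (?\<chi> s)" and r: "r \<in> S" "\<not> liftable (?\<chi> r)" for s r
  proof -
    obtain b where b: "b \<in> socle_lift" "\<And>x. x \<in> carrier G \<Longrightarrow> commutator b x = ?\<chi> s x"
      using socle_hom_realised[OF socle_hom_index_le_two[OF N_index[OF s(1)] t(3)]] by metis
    obtain c where c: "c \<in> socle_lift" "\<And>x. x \<in> carrier G \<Longrightarrow> commutator c x = ?\<chi> r x"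
      using socle_hom_realised[OF socle_hom_index_le_two[OF N_index[OF r(1)] t(3)]] by metis
    let ?cl = "\<lambda>x. square_class (x \<otimes> x)"
    have one: "\<one> \<in> socle_lift" "\<And>x. x \<in> carrier G \<Longrightarrow> commutator \<one> x = \<one>"
      by (auto simp: subgroup.one_closed[OF socle_lift_subgroup] commutator_def)
    \<comment> \<open>Comparison with the identity: a square in the trivial class would make the
      form itself liftable.\<close>
    have "?cl b \<noteq> ?cl \<one>"
    proof
      assume "?cl b = ?cl \<one>"
      from liftable_prod_if_square_class[OF b one this] have "liftable (?\<chi> s)"
        by (rule liftable_cong) (simp_all add: socle_closed[OF t(3)])
      then show False using s by simp
    qed
    moreover have "?cl c \<noteq> ?cl \<one>"
    proof
      assume "?cl c = ?cl \<one>"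
      from liftable_prod_if_square_class[OF c one this] have "liftable (?\<chi> r)"
        by (rule liftable_cong) (simp_all add: socle_closed[OF t(3)])
      then show False using r by simp
    qed
    moreover have "{?cl b, ?cl c, ?cl \<one>} \<subseteq> square_class ` centre"
      using socle_lift_square_centre[OF b(1)] socle_lift_square_centre[OF c(1)]
        socle_lift_square_centre[OF one(1)] by blast
    moreover obtain u v where "square_class ` centre = {u, v}"
      using card_square_class[OF fin] soc by (auto simp: card_2_iff)
    ultimately have "?cl b = ?cl c" by auto
    then show ?thesis
      using b c by (intro liftable_prod_if_square_class[of b _ c]) simp_all
  qed
  define bad where "bad s \<longleftrightarrow> \<not> liftable (?\<chi> s)" for s
  \<comment> \<open>A bad coordinate if there is one, and an arbitrary coordinate otherwise.\<close>
  obtain s0 where s0: "s0 \<in> S" "\<And>s. \<lbrakk>s \<in> S; bad s\<rbrakk> \<Longrightarrow> bad s0"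
  proof (cases "\<exists>s\<in>S. bad s")
    case True then show thesis using that by blast
  next
    case False
    moreover have "S \<noteq> {}" using d by auto
    ultimately show thesis using that by blast
  qed
  define T where "T = S - {s0}"
  \<comment> \<open>Adding the coordinate of \<open>s0\<close> to the other bad coordinates turns them into liftable ones with the
    same values on \<open>T\<close>.\<close>
  define K where "K s = (if bad s then {x \<in> carrier G. x \<in> N s \<longleftrightarrow> x \<in> N s0} else N s)" for s
  have TS: "T \<subseteq> S" by (auto simp: T_def)
  have K1: "index_le_two (K s)" if "s \<in> T" for s
  proof -
    have "s \<in> S" using that TS by blast
    then show ?thesis
      using index_le_two_mult[OF N_index] N_index s0 unfolding K_def
      by (auto simp: index_le_two_def)
  qed
  \<comment> \<open>The coordinate at \<open>s0\<close> vanishes on \<open>T\<close>, so the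
    modified coordinates are still dual to \<open>T\<close>.\<close>
  have K2: "r \<in> K s \<longleftrightarrow> r \<noteq> s" if "s \<in> T" "r \<in> T" for s r
    using that S_closed dual[of s r] dual[of s0 r] s0 by (auto simp: K_def T_def)
  have lift: "liftable (\<lambda>x. if x \<in> K s then \<one> else r)" if s: "s \<in> T" and r: "r \<in> socle" for s r
  proof (cases "r = t")
    case False
    then have "r = \<one>" using r t by auto
    then show ?thesis by (intro liftable_cong[OF liftable_one]) simp
  next
    case True
    have sS: "s \<in> S" using s TS by blast
    show ?thesis
    proof (cases "bad s")
      case False
      then show ?thesis unfolding True by (simp add: K_def bad_def)
    next
      case bad: True
      then have "liftable (\<lambda>x. ?\<chi> s x \<otimes> ?\<chi> s0 x)"
        using two_bad[OF sS _ s0(1)] s0(2)[OF sS bad] by (simp add: bad_def)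
      then show ?thesis
        by (rule liftable_cong)
          (use bad True socle_square[OF t(3)] socle_closed[OF t(3)] in \<open>auto simp: K_def\<close>)
    qed
  qed
  let ?M = "{p. p \<subseteq> T \<and> card p = 2} \<rightarrow>\<^sub>E socle"
  obtain q where q: "\<And>m. m \<in> ?M \<Longrightarrow> quadratic (q m)"
    "\<And>m s t. \<lbrakk>m \<in> ?M; s \<in> T; t \<in> T; s \<noteq> t\<rbrakk> \<Longrightarrow> polar (q m) s t = m {s, t}"
    "\<And>m y. \<lbrakk>m \<in> ?M; y \<in> carrier G;
      \<And>s r. \<lbrakk>s \<in> T; r \<in> socle\<rbrakk> \<Longrightarrow> liftable (\<lambda>x. if x \<in> K s then \<one> else r)\<rbrakk> \<Longrightarrow>
      liftable (\<lambda>x. polar (q m) x y)"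
  proof (rule polar_family[OF K1 K2 TS], assumption+, goal_cases)
    case (1 q)
    show thesis by (rule that) (fact 1)+
  qed
  have "card ?M \<le> 2 ^ card S"
  proof (rule card_quadratic_family_le[OF q(1)])
    fix m s assume "m \<in> ?M" "s \<in> S"
    then show "liftable (\<lambda>x. polar (q m) x s)" using S_closed by (intro q(3) lift) auto
  next
    fix m m' assume m: "m \<in> ?M" "m' \<in> ?M"
      and eq: "\<And>s t. \<lbrakk>s \<in> S; t \<in> S\<rbrakk> \<Longrightarrow> polar (q m) s t = polar (q m') s t"
    show "m = m'"
    proof (rule polar_family_inj[OF m])
      fix s t assume st: "s \<in> T" "t \<in> T" "s \<noteq> t"
      have "polar (q m) s t = polar (q m') s t" by (rule eq) (use st TS in blast)+
      then show "m {s, t} = m' {s, t}" using q(2)[OF m(1) st] q(2)[OF m(2) st] by simp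
    qed
  qed
  then have "2 ^ (card T choose 2) \<le> (2::nat) ^ card S" using card_pairs(1)[OF TS] soc by simp
  then have le: "card T choose 2 \<le> card S" by simp
  obtain k where k: "card S = k + 5" using d by (metis add.commute le_Suc_ex)
  have "card T = k + 4" using s0(1) finite_S k by (simp add: T_def)
  then have "(k + 4) * (k + 4 - 1) div 2 \<le> k + 5" using le k by (simp only: choose_two)
  \<comment> \<open>With d = k + 5 this bounds (d-1)(d-2)/2 from below by d + 1.\<close>
  moreover have "2 * (k + 6) \<le> (k + 4) * (k + 4 - 1)" by (simp add: algebra_simps)
  then have "2 * (k + 6) div 2 \<le> (k + 4) * (k + 4 - 1) div 2" by (rule div_le_mono)
  ultimately show False by simp
qed

lemma card_generators_le_4: "card S \<le> 4"
proof (rule ccontr)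
  assume "\<not> card S \<le> 4"
  then have d: "card S \<ge> 5" by simp
  have "finite socle" using finite_subset[OF _ fin] socle_closed by blast
  moreover obtain t where "t \<in> socle" "t \<noteq> \<one>" using core_socle by blast
  ultimately have "card {\<one>, t} \<le> card socle" by (intro card_mono) auto
  then have "card socle = 2 \<or> card socle \<ge> 3" using \<open>t \<noteq> \<one>\<close> by auto
  then show False using small_socle_contradiction[OF d] large_socle_contradiction[OF d] by blast
qed

end

text \<open>If the conclusion fails, the group is an instance of both locales, and
  \<open>card_generators_le_4\<close> contradicts the bound on generators. By the index shift,
  \<open>lower_central G 1\<close> is the derived subgroup and \<open>lower_central G 2\<close> the
  last nontrivial term.\<close>

lemma (in group) noninner_involution_fixing_frattini:
  assumes "finite (carrier G)" "order G = 2 ^ n" "nilpotent_of_class G 3" "min_generators G > 4"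
  shows "\<exists>f \<in> auto G. f \<notin> inner_auto G
           \<and> group.ord (AutoGroup G) f = 2
           \<and> (\<forall>x \<in> frattini G. f x = x)"
proof (rule ccontr)
  assume none: "\<not> ?thesis"
  have lc: "lower_central G 3 = {\<one>}" and lc2: "lower_central G 2 \<noteq> {\<one>}"
    using assms(3) by (auto simp: nilpotent_of_class_def)
  have class3: "commutator x y \<in> centre" if "x \<in> lower_central G 1" "y \<in> carrier G" for x y
  proof (rule centre_if_commutator)
    have "x \<in> carrier G" using that(1) subgroup.mem_carrier[OF lower_central_subgroup] by blast
    then show "commutator x y \<in> carrier G" using that by simp
    fix z assume z: "z \<in> carrier G"
    have "commutator (commutator x y) z \<in> lower_central G (Suc (Suc 1))"
      using that z by (intro commutator_lower_central)
    then show "commutator (commutator x y) z = \<one>" using lc by (simp add: numeral_3_eq_3 numeral_2_eq_2)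
  qed
  have com1: "commutator x y \<in> lower_central G 1" if "x \<in> carrier G" "y \<in> carrier G" for x y
    using commutator_lower_central[of x 0 y] that by simp
  have "\<exists>t\<in>socle \<inter> index_two_core. t \<noteq> \<one>"
  proof -
    \<comment> \<open>Here the class being exactly three is used: the term with index 2 is
      nontrivial, so one of its generating commutators is.\<close>
    have "\<exists>x y. x \<in> lower_central G 1 \<and> y \<in> carrier G \<and> commutator x y \<noteq> \<one>"
    proof (rule ccontr)
      assume "\<not> ?thesis"
      then have "{x \<otimes> y \<otimes> inv x \<otimes> inv y |x y. x \<in> lower_central G 1 \<and> y \<in> carrier G} \<subseteq> {\<one>}"
        by (auto simp: commutator_def)
      then have "lower_central G (Suc 1) \<subseteq> {\<one>}"
        unfolding lower_central.simps by (intro generate_subgroup_incl triv_subgroup)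
      then show False
        using lc2 subgroup.one_closed[OF lower_central_subgroup, of 2] by (auto simp: numeral_2_eq_2)
    qed
    then obtain x y where xy: "x \<in> lower_central G 1" "y \<in> carrier G" "commutator x y \<noteq> \<one>" by blast
    have xc: "x \<in> carrier G" using xy(1) subgroup.mem_carrier[OF lower_central_subgroup] by blast
    define a where "a = commutator x y"
    have a: "a \<in> carrier G" "a \<in> centre" "a \<in> index_two_core" "a \<noteq> \<one>"
      using xy xc class3 commutator_index_two_core by (auto simp: a_def)
    have pw: "a [^] k \<in> centre \<inter> index_two_core" for k :: nat
    proof (induction k)
      case 0
      show ?case
        by (auto simp: subgroup.one_closed[OF centre_subgroup] index_two_core_def index_le_two_one)
    qed (use a in \<open>auto simp: centre_mult index_two_core_mult\<close>)
    \<comment> \<open>The last nontrivial element in the chain of repeated squares of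
      \<open>a\<close> is an involution, and as a power of \<open>a\<close> it stays central and in
      the core.\<close>
    define k where "k = (LEAST k. a [^] ((2::nat) ^ k) = \<one>)"
    have k: "a [^] ((2::nat) ^ k) = \<one>"
      unfolding k_def by (rule LeastI[of _ n]) (use a(1) pow_order_eq_1 assms(2) in metis)
    have "k \<noteq> 0" using k a by (auto intro: gr0I)
    then obtain j where j: "k = Suc j" by (cases k) auto
    define t where "t = a [^] ((2::nat) ^ j)"
    have "t \<noteq> \<one>"
      using not_less_Least[of j "\<lambda>k. a [^] ((2::nat) ^ k) = \<one>"] j by (simp add: k_def t_def)
    moreover have "t \<otimes> t = \<one>"
      using k a(1) by (simp add: j t_def nat_pow_mult mult_2)
    ultimately show ?thesis using pw[of "2 ^ j"] by (auto simp: t_def socle_def)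
  qed
  moreover have "\<exists>c\<in>carrier G. \<forall>x\<in>carrier G. f x = c \<otimes> x \<otimes> inv c"
    if f: "\<And>x. x \<in> carrier G \<Longrightarrow> f x \<in> carrier G"
      "\<And>x y. \<lbrakk>x \<in> carrier G; y \<in> carrier G\<rbrakk> \<Longrightarrow> f (x \<otimes> y) = f x \<otimes> f y"
      "\<And>x. x \<in> carrier G \<Longrightarrow> f (f x) = x" "\<And>x. x \<in> frattini G \<Longrightarrow> f x = x" for f
  proof (rule ccontr)
    assume outer: "\<not> ?thesis"
    have "\<forall>x\<in>frattini G. restrict f (carrier G) x = x"
      using f(4) by (auto simp: frattini_def)
    with involution_auto[OF f(1-3) outer] none show False by blast
  qed
  ultimately interpret inner_frattini_involutions G
    by unfold_locales (use assms(1) in blast)+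
  obtain S N where SN: "finite S" "S \<subseteq> carrier G" "card S = min_generators G" "generate G S = carrier G"
    "\<And>s. s \<in> S \<Longrightarrow> index_le_two (N s)"
    "\<And>s t. \<lbrakk>s \<in> S; t \<in> S\<rbrakk> \<Longrightarrow> t \<in> N s \<longleftrightarrow> t \<noteq> s"
    using min_generators_dual[OF assms(1,2) lc] by blast
  interpret dual_generators G S N
  proof unfold_locales
    fix x y assume "x \<in> carrier G" "y \<in> carrier G"
    then show "commutator x y \<in> second_centre"
      using com1 class3 by (simp add: second_centre_def)
  qed (use SN in auto)
  show False using card_generators_le_4 SN(3) assms(4) by simp
qed

theorem theorem4p6:
  fixes G :: "('a, 'b) monoid_scheme" and n :: nat
  assumes "group G"
    and "finite (carrier G)"
    and "order G = 2 ^ n"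
    and "nilpotent_of_class G 3"
    and "min_generators G > 4"
  shows "\<exists>f \<in> auto G. f \<notin> inner_auto G
           \<and> group.ord (AutoGroup G) f = 2
           \<and> (\<forall>x \<in> frattini G. f x = x)"
  using group.noninner_involution_fixing_frattini[OF assms] .

end
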